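(* Let $\mathcal{I}_1$ and $\mathcal{I}_2$ be ideals of polynomials such that $\mathcal{P}_{\mathcal{I}_1}(^{n}E;F)\subset\mathcal{P}_{\mathcal{I}_2}(^{n}E;F)$ for some Banach spaces $E$ and $F$ and some natural number $n$. Suppose that the following hold: (i) if $P\in\mathcal{P}_{\mathcal{I}_2}(^{n}E;F)$, then $\overset{\vee}{P}(\cdot,a,\dots,a)\in\mathcal{L}_{\mathcal{I}_2}(E;F)$ for every fixed $a\in E$; (ii) for all $m<n$, if $P\in\mathcal{P}_{\mathcal{I}_1}(^{m}E;F)$ and $\varphi\in\mathcal{L}(E;\mathbb{K})$, then $P\cdot\varphi\in\mathcal{P}_{\mathcal{I}_1}(^{m+1}E;F)$. Then $\mathcal{L}_{\mathcal{I}_1}(E;F)\subset\mathcal{L}_{\mathcal{I}_2}(E;F)$.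
   Context: Banach spaces are over $\mathbb{K}=\mathbb{R}$ or $\mathbb{C}$. $\mathcal{L}(E;F)$ is the space of continuous linear operators and $\mathcal{P}(^{n}E;F)$ the space of continuous $n$-homogeneous polynomials $E\to F$ ($n\ge1$); $\overset{\vee}{P}$ is the unique symmetric continuous $n$-linear mapping associated to $P\in\mathcal{P}(^nE;F)$. $P\cdot\varphi$ denotes the polynomial $x\mapsto\varphi(x)P(x)$. An ideal of polynomials $\mathcal{I}$ is a subclass of the class of all continuous homogeneous polynomials between Banach spaces such that for all $n\geq 1$ and all Banach spaces $E,F$ the components $\mathcal{P}_{\mathcal{I}}(^{n}E;F)=\mathcal{P}(^{n}E;F)\cap\mathcal{I}$ satisfy: (a) $\mathcal{P}_{\mathcal{I}}(^{n}E;F)$ is a linear subspace of $\mathcal{P}(^{n}E;F)$ containing the polynomials of finite type (finite sums of polynomials $x\mapsto\varphi(x)^n y$ with $\varphi\in E'$, $y\in F$, and scalar multiples of these); (b) if $P\in\mathcal{P}_{\mathcal{I}}(^{n}E;F)$, $\varphi_1\in\mathcal{L}(G;E)$ and $\varphi_2\in\mathcal{L}(F;H)$, then $\varphi_2\circ P\circ\varphi_1\in\mathcal{P}_{\mathcal{I}}(^{n}G;H)$. The linear component ($n=1$) is written $\mathcal{L}_{\mathcal{I}}(E;F)=\mathcal{P}_{\mathcal{I}}(^{1}E;F)$. *)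

theory Defs
  imports "HOL-Analysis.Analysis" "HOL-Algebra.Module"
begin

text \<open>
  The class of all Banach spaces has to be quantified over, so Banach spaces are carrier-based
  objects: modules in the sense of \<open>HOL-Algebra\<close> with a norm.  The scalar field is given as a
  set \<open>K\<close> of complex numbers, which is meant to be \<open>\<real>\<close> or \<open>UNIV\<close>.
\<close>

definition scalar_field :: "complex set \<Rightarrow> complex ring" where
  "scalar_field K = \<lparr>carrier = K, monoid.mult = (*), one = 1, zero = 0, add = (+)\<rparr>"

text \<open>The multiplicative fields \<open>mult\<close> and \<open>one\<close> inherited from \<open>ring\<close> are not used.\<close>

record 'a normed_module = "(complex, 'a) module" +
  nrm :: "'a \<Rightarrow> real"

text \<open>\<open>Metric_space\<close> demands symmetry and nonnegativity also off the carrier, hence the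
  case distinction.\<close>

definition ndist :: "'a normed_module \<Rightarrow> 'a \<Rightarrow> 'a \<Rightarrow> real" where
  "ndist E x y = (if x \<in> carrier E \<and> y \<in> carrier E then nrm E (x \<ominus>\<^bsub>E\<^esub> y) else 0)"

definition ntop :: "'a normed_module \<Rightarrow> 'a topology" where
  "ntop E = Metric_space.mtopology (carrier E) (ndist E)"

locale banach_space =
  Module.module "scalar_field K" E for K :: "complex set" and E :: "'a normed_module" (structure) +
  assumes nrm_nonneg: "x \<in> carrier E \<Longrightarrow> 0 \<le> nrm E x"
    and nrm_eq_0_iff: "x \<in> carrier E \<Longrightarrow> nrm E x = 0 \<longleftrightarrow> x = \<zero>"
    and nrm_smult: "c \<in> K \<Longrightarrow> x \<in> carrier E \<Longrightarrow> nrm E (c \<odot> x) = cmod c * nrm E x"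
    and nrm_triangle: "x \<in> carrier E \<Longrightarrow> y \<in> carrier E \<Longrightarrow> nrm E (x \<oplus> y) \<le> nrm E x + nrm E y"
    and complete: "Metric_space.mcomplete (carrier E) (ndist E)"

definition scalar_space :: "complex set \<Rightarrow> complex normed_module" where
  "scalar_space K = \<lparr>carrier = K, monoid.mult = (*), one = 1, zero = 0, add = (+),
     smult = (*), nrm = cmod\<rparr>"

lemma (in banach_space) metric_space: "Metric_space (carrier E) (ndist E)"
proof
  have minus_sym: "nrm E (x \<ominus> y) = nrm E (y \<ominus> x)" if "x \<in> carrier E" "y \<in> carrier E" for x y
  proof -
    have m1: "-1 \<in> K"
    proof -
      let ?z = "a_inv (scalar_field K) 1"
      have "?z \<in> K" "1 + ?z = 0"
        using R.a_inv_closed[of 1] R.r_neg[of 1] R.one_closed by (simp_all add: scalar_field_def)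
      moreover have "?z = -1" using \<open>1 + ?z = 0\<close> by (simp add: add_eq_0_iff)
      ultimately show ?thesis by simp
    qed
    have "x \<ominus> y = \<ominus> (y \<ominus> x)"
      using that by (simp add: a_minus_def minus_add a_comm)
    also have "\<dots> = (-1) \<odot> (y \<ominus> x)"
    proof -
      have "(-1) \<odot> (y \<ominus> x) \<oplus> (1 \<odot> (y \<ominus> x)) = (-1 + 1) \<odot> (y \<ominus> x)"
        using smult_l_distr[of "-1" 1 "y \<ominus> x"] that m1 R.one_closed by (simp add: scalar_field_def)
      moreover have "1 \<odot> (y \<ominus> x) = y \<ominus> x" using smult_one[of "y \<ominus> x"] that by (simp add: scalar_field_def)
      moreover have "0 \<odot> (y \<ominus> x) = \<zero>" using smult_l_null[of "y \<ominus> x"] that by (simp add: scalar_field_def)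
      ultimately have "(-1) \<odot> (y \<ominus> x) \<oplus> (y \<ominus> x) = \<zero>" by simp
      moreover have "(-1) \<odot> (y \<ominus> x) \<in> carrier E" using smult_closed[of "-1" "y \<ominus> x"] m1 that by (simp add: scalar_field_def)
      ultimately show ?thesis using that minus_equality by (metis M.minus_closed)
    qed
    finally show ?thesis using nrm_smult[of "-1" "y \<ominus> x"] m1 that by simp
  qed
  fix x y z
  show "0 \<le> ndist E x y" by (simp add: ndist_def nrm_nonneg)
  show "ndist E x y = ndist E y x" by (simp add: ndist_def minus_sym)
  { assume "x \<in> carrier E" "y \<in> carrier E"
    moreover have "x = y" if "x \<ominus> y = \<zero>"
    proof -
      have "x = (x \<ominus> y) \<oplus> y" using calculation by (simp add: a_minus_def a_assoc M.l_neg)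
      then show ?thesis using that calculation by simp
    qed
    moreover have "x \<ominus> x = \<zero>" using calculation by (simp add: a_minus_def M.r_neg)
    ultimately show "ndist E x y = 0 \<longleftrightarrow> x = y"
      by (auto simp: ndist_def nrm_eq_0_iff) }
  { assume c: "x \<in> carrier E" "y \<in> carrier E" "z \<in> carrier E"
    have "x \<ominus> z = (x \<ominus> y) \<oplus> (y \<ominus> z)"
      using c by (simp add: a_minus_def a_assoc M.r_neg1 M.r_neg2)
    then show "ndist E x z \<le> ndist E x y + ndist E y z"
      using c nrm_triangle[of "x \<ominus> y" "y \<ominus> z"] by (simp add: ndist_def) }
qed

lemma banach_scalar_space:
  assumes K: "K = \<real> \<or> K = UNIV"
  shows "banach_space K (scalar_space K)"
proof -
  have cl: "x + y \<in> K" "x * y \<in> K" "- x \<in> K" "0 \<in> K" "1 \<in> K" if "x \<in> K" "y \<in> K" for x y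
    using K that by auto
  have cl01: "0 \<in> K" "1 \<in> K" using K by auto
  have minv: "\<exists>y\<in>K. y + x = 0" "\<exists>y\<in>K. x + y = 0" if "x \<in> K" for x using cl(3)[OF that that] by (auto intro!: bexI[of _ "-x"])
  have cr: "cring (scalar_field K)"
  proof (rule cringI)
    show "abelian_group (scalar_field K)"
      by (rule abelian_groupI) (simp_all add: scalar_field_def cl cl01 minv algebra_simps)
    show "comm_monoid (scalar_field K)"
      by (rule comm_monoidI) (simp_all add: scalar_field_def cl cl01 algebra_simps)
  qed (simp add: scalar_field_def algebra_simps)
  have ag: "abelian_group (scalar_space K)"
    by (rule abelian_groupI) (simp_all add: scalar_space_def cl cl01 minv algebra_simps)
  interpret A: abelian_group "scalar_space K" by (rule ag)
  have md: "Module.module (scalar_field K) (scalar_space K)"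
    by (rule moduleI[OF cr ag]) (simp_all add: scalar_field_def scalar_space_def cl algebra_simps)
  have inv: "\<ominus>\<^bsub>scalar_space K\<^esub> y = - y" if "y \<in> K" for y
    using that cl(3)[OF that that] by (intro A.minus_equality) (simp_all add: scalar_space_def)
  have nd: "ndist (scalar_space K) x y = dist x y" if "x \<in> K" "y \<in> K" for x y
    using that inv[OF that(2)] by (simp add: ndist_def a_minus_def dist_norm) (simp add: scalar_space_def)
  have cK: "complete K" using K complete_eq_closed closed_complex_Reals by auto
  let ?S = "scalar_space K"
  have c: "carrier ?S = K" by (simp add: scalar_space_def)
  have ax: "banach_space_axioms K ?S" if ms: "Metric_space.mcomplete K (ndist ?S)"
    unfolding banach_space_axioms_def c using ms
    by (auto simp: scalar_space_def norm_mult norm_triangle_ineq)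
  interpret Metric_space K "ndist ?S"
  proof
    fix x y z
    have "\<not> (x \<in> K \<and> y \<in> K) \<Longrightarrow> ndist ?S x y = 0" for x y by (auto simp: ndist_def c)
    note * = this
    show "0 \<le> ndist ?S x y" using * nd by (cases "x \<in> K \<and> y \<in> K") auto
    show "ndist ?S x y = ndist ?S y x" using *[of x y] *[of y x] nd dist_commute by (cases "x \<in> K \<and> y \<in> K") auto
  qed (auto simp: nd dist_triangle)
  have "mcomplete"
    unfolding mcomplete_def
  proof (intro allI impI)
    fix s assume s: "MCauchy s"
    then have r: "range s \<subseteq> K" by (simp add: MCauchy_def)
    have "Cauchy s" using s r nd unfolding MCauchy_def Cauchy_def by (metis range_subsetD)
    then obtain l where l: "l \<in> K" "s \<longlonglongrightarrow> l" using cK r unfolding complete_def by blast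
    then show "\<exists>x. limitin mtopology s x sequentially"
      using nd r unfolding limitin_metric tendsto_iff
      by (intro exI[of _ l]) (auto simp: range_subsetD elim!: eventually_mono)
  qed
  then show ?thesis using md ax by (intro banach_space.intro)
qed

text \<open>Maps between spaces are extensional (\<open>undefined\<close> off the carrier), so that equality of
  HOL functions is equality of maps.\<close>

definition lin_ops :: "complex set \<Rightarrow> 'a normed_module \<Rightarrow> 'b normed_module \<Rightarrow> ('a \<Rightarrow> 'b) set" where
  "lin_ops K E F = {T \<in> carrier E \<rightarrow>\<^sub>E carrier F.
     (\<forall>x\<in>carrier E. \<forall>y\<in>carrier E. T (x \<oplus>\<^bsub>E\<^esub> y) = T x \<oplus>\<^bsub>F\<^esub> T y) \<and>
     (\<forall>c\<in>K. \<forall>x\<in>carrier E. T (c \<odot>\<^bsub>E\<^esub> x) = c \<odot>\<^bsub>F\<^esub> T x) \<and>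
     continuous_map (ntop E) (ntop F) T}"

text \<open>\<open>n\<close>-tuples in \<open>E\<close> are the elements of \<open>{..<n} \<rightarrow>\<^sub>E carrier E\<close>.\<close>

definition multilinear ::
  "complex set \<Rightarrow> nat \<Rightarrow> 'a normed_module \<Rightarrow> 'b normed_module \<Rightarrow> ((nat \<Rightarrow> 'a) \<Rightarrow> 'b) set" where
  "multilinear K n E F = {A \<in> ({..<n} \<rightarrow>\<^sub>E carrier E) \<rightarrow>\<^sub>E carrier F.
     \<forall>x \<in> {..<n} \<rightarrow>\<^sub>E carrier E. \<forall>i<n.
       (\<forall>u\<in>carrier E. \<forall>v\<in>carrier E. A (x(i := u \<oplus>\<^bsub>E\<^esub> v)) = A (x(i := u)) \<oplus>\<^bsub>F\<^esub> A (x(i := v))) \<and>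
       (\<forall>c\<in>K. \<forall>u\<in>carrier E. A (x(i := c \<odot>\<^bsub>E\<^esub> u)) = c \<odot>\<^bsub>F\<^esub> A (x(i := u)))}"

definition cont_multilinear ::
  "complex set \<Rightarrow> nat \<Rightarrow> 'a normed_module \<Rightarrow> 'b normed_module \<Rightarrow> ((nat \<Rightarrow> 'a) \<Rightarrow> 'b) set" where
  "cont_multilinear K n E F = {A \<in> multilinear K n E F.
     continuous_map (product_topology (\<lambda>_. ntop E) {..<n}) (ntop F) A}"

definition symmetric_map :: "nat \<Rightarrow> 'a normed_module \<Rightarrow> ((nat \<Rightarrow> 'a) \<Rightarrow> 'b) \<Rightarrow> bool" where
  "symmetric_map n E A \<longleftrightarrow>
     (\<forall>p. p permutes {..<n} \<longrightarrow> (\<forall>x \<in> {..<n} \<rightarrow>\<^sub>E carrier E. A (x \<circ> p) = A x))"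

definition cont_polys ::
  "complex set \<Rightarrow> nat \<Rightarrow> 'a normed_module \<Rightarrow> 'b normed_module \<Rightarrow> ('a \<Rightarrow> 'b) set" where
  "cont_polys K n E F = {P \<in> carrier E \<rightarrow>\<^sub>E carrier F.
     (\<exists>A \<in> multilinear K n E F. \<forall>x\<in>carrier E. P x = A (\<lambda>i\<in>{..<n}. x)) \<and>
     continuous_map (ntop E) (ntop F) P}"

lemma cont_polys_1:
  assumes "banach_space K E"
  shows "cont_polys K 1 E F = lin_ops K E F"
proof -
  interpret E: banach_space K E by fact
  have ad: "u \<oplus>\<^bsub>E\<^esub> v \<in> carrier E" if "u \<in> carrier E" "v \<in> carrier E" for u v using that by simp
  have sm: "c \<odot>\<^bsub>E\<^esub> v \<in> carrier E" if "c \<in> K" "v \<in> carrier E" for c v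
    using E.smult_closed[of c v] that by (simp add: scalar_field_def)
  { fix P assume "P \<in> cont_polys K 1 E F"
    then obtain A where P: "P \<in> carrier E \<rightarrow>\<^sub>E carrier F" "continuous_map (ntop E) (ntop F) P"
      and A: "A \<in> multilinear K 1 E F" and PA: "\<And>x. x \<in> carrier E \<Longrightarrow> P x = A (\<lambda>i\<in>{..<1::nat}. x)"
      unfolding cont_polys_def mem_Collect_eq by (elim conjE bexE) (rule that, auto)
    have t: "(\<lambda>i\<in>{..<1::nat}. \<zero>\<^bsub>E\<^esub>) \<in> {..<1::nat} \<rightarrow>\<^sub>E carrier E" by (simp add: restrict_PiE_iff)
    have upd: "(\<lambda>i\<in>{..<1::nat}. \<zero>\<^bsub>E\<^esub>)(0 := u) = (\<lambda>i\<in>{..<1::nat}. u)" for u by (simp add: fun_eq_iff)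
    from A have "(\<forall>u\<in>carrier E. \<forall>v\<in>carrier E. A ((\<lambda>i\<in>{..<1::nat}. \<zero>\<^bsub>E\<^esub>)(0 := u \<oplus>\<^bsub>E\<^esub> v)) = A ((\<lambda>i\<in>{..<1::nat}. \<zero>\<^bsub>E\<^esub>)(0 := u)) \<oplus>\<^bsub>F\<^esub> A ((\<lambda>i\<in>{..<1::nat}. \<zero>\<^bsub>E\<^esub>)(0 := v))) \<and>
       (\<forall>c\<in>K. \<forall>u\<in>carrier E. A ((\<lambda>i\<in>{..<1::nat}. \<zero>\<^bsub>E\<^esub>)(0 := c \<odot>\<^bsub>E\<^esub> u)) = c \<odot>\<^bsub>F\<^esub> A ((\<lambda>i\<in>{..<1::nat}. \<zero>\<^bsub>E\<^esub>)(0 := u)))"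
      using A[unfolded multilinear_def mem_Collect_eq, THEN conjunct2, THEN bspec, OF t, rule_format, OF zero_less_one] by simp
    then have "P \<in> lin_ops K E F"
      unfolding upd lin_ops_def mem_Collect_eq using P by (simp add: PA ad sm) }
  note 1 = this
  { fix P assume P: "P \<in> lin_ops K E F"
    have Pl: "P \<in> carrier E \<rightarrow>\<^sub>E carrier F"
       "\<And>x y. x \<in> carrier E \<Longrightarrow> y \<in> carrier E \<Longrightarrow> P (x \<oplus>\<^bsub>E\<^esub> y) = P x \<oplus>\<^bsub>F\<^esub> P y"
       "\<And>c x. c \<in> K \<Longrightarrow> x \<in> carrier E \<Longrightarrow> P (c \<odot>\<^bsub>E\<^esub> x) = c \<odot>\<^bsub>F\<^esub> P x"
      using P unfolding lin_ops_def mem_Collect_eq by simp_all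
    define A where "A = (\<lambda>x \<in> {..<1::nat} \<rightarrow>\<^sub>E carrier E. P (x 0))"
    have t: "x(0 := u) \<in> {..<1::nat} \<rightarrow>\<^sub>E carrier E" if "x \<in> {..<1::nat} \<rightarrow>\<^sub>E carrier E" "u \<in> carrier E" for x u
      using that by (simp add: PiE_iff extensional_def)
    have A0: "A (x(0 := u)) = P u" if "x \<in> {..<1::nat} \<rightarrow>\<^sub>E carrier E" "u \<in> carrier E" for x u
      using t[OF that] by (simp add: A_def)
    have "A \<in> multilinear K 1 E F"
      unfolding multilinear_def mem_Collect_eq
    proof (intro conjI ballI allI impI)
      show "A \<in> ({..<1::nat} \<rightarrow>\<^sub>E carrier E) \<rightarrow>\<^sub>E carrier F"
        unfolding A_def using Pl(1) unfolding restrict_PiE_iff by (intro ballI PiE_mem[OF Pl(1)]) (erule PiE_mem, simp)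
    next
      fix x and i :: nat and u v assume x: "x \<in> {..<1::nat} \<rightarrow>\<^sub>E carrier E" "i < 1" "u \<in> carrier E" "v \<in> carrier E"
      then show "A (x(i := u \<oplus>\<^bsub>E\<^esub> v)) = A (x(i := u)) \<oplus>\<^bsub>F\<^esub> A (x(i := v))"
        by (simp add: A0 Pl ad)
    next
      fix x and i :: nat and c u assume x: "x \<in> {..<1::nat} \<rightarrow>\<^sub>E carrier E" "i < 1" "c \<in> K" "u \<in> carrier E"
      then show "A (x(i := c \<odot>\<^bsub>E\<^esub> u)) = c \<odot>\<^bsub>F\<^esub> A (x(i := u))"
        by (simp add: A0 Pl sm)
    qed
    moreover have "\<forall>x\<in>carrier E. P x = A (\<lambda>i\<in>{..<1::nat}. x)" unfolding A_def by (simp add: restrict_PiE_iff)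
    ultimately have "P \<in> cont_polys K 1 E F"
      using P unfolding cont_polys_def lin_ops_def mem_Collect_eq by (intro conjI) (auto intro: bexI[of _ A]) }
  with 1 show ?thesis by blast
qed

definition assoc_multilinear ::
  "complex set \<Rightarrow> nat \<Rightarrow> 'a normed_module \<Rightarrow> 'b normed_module \<Rightarrow> ('a \<Rightarrow> 'b) \<Rightarrow> (nat \<Rightarrow> 'a) \<Rightarrow> 'b" where
  "assoc_multilinear K n E F P = (THE A. A \<in> cont_multilinear K n E F \<and> symmetric_map n E A \<and>
     (\<forall>x\<in>carrier E. A (\<lambda>i\<in>{..<n}. x) = P x))"

definition poly_space ::
  "complex set \<Rightarrow> nat \<Rightarrow> 'a normed_module \<Rightarrow> 'b normed_module \<Rightarrow> (complex, 'a \<Rightarrow> 'b) module" where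
  "poly_space K n E F = \<lparr>carrier = cont_polys K n E F,
     monoid.mult = undefined, one = undefined,
     zero = (\<lambda>x\<in>carrier E. \<zero>\<^bsub>F\<^esub>),
     add = (\<lambda>P Q. \<lambda>x\<in>carrier E. P x \<oplus>\<^bsub>F\<^esub> Q x),
     smult = (\<lambda>c P. \<lambda>x\<in>carrier E. c \<odot>\<^bsub>F\<^esub> P x)\<rparr>"

definition finite_type_polys ::
  "complex set \<Rightarrow> nat \<Rightarrow> 'a normed_module \<Rightarrow> 'b normed_module \<Rightarrow> ('a \<Rightarrow> 'b) set" where
  "finite_type_polys K n E F =
     {\<lambda>x\<in>carrier E. \<Oplus>\<^bsub>F\<^esub>j\<in>{..<m}. c j \<odot>\<^bsub>F\<^esub> (\<phi> j x ^ n \<odot>\<^bsub>F\<^esub> y j) | (m :: nat) c \<phi> y.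
        \<forall>j<m. c j \<in> K \<and> \<phi> j \<in> lin_ops K E (scalar_space K) \<and> y j \<in> carrier F}"

definition poly_times_functional ::
  "'a normed_module \<Rightarrow> 'b normed_module \<Rightarrow> ('a \<Rightarrow> 'b) \<Rightarrow> ('a \<Rightarrow> complex) \<Rightarrow> 'a \<Rightarrow> 'b" where
  "poly_times_functional E F P \<phi> = (\<lambda>x\<in>carrier E. \<phi> x \<odot>\<^bsub>F\<^esub> P x)"

text \<open>A class of polynomials consists of triples (domain, codomain, map).  The spaces range over
  all Banach spaces with carrier in the arbitrary type \<open>'u\<close>, which plays the role of a universe.\<close>

type_synonym 'u poly_class = "('u normed_module \<times> 'u normed_module \<times> ('u \<Rightarrow> 'u)) set"

definition component ::
  "complex set \<Rightarrow> 'u poly_class \<Rightarrow> nat \<Rightarrow> 'u normed_module \<Rightarrow> 'u normed_module \<Rightarrow> ('u \<Rightarrow> 'u) set" where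
  "component K I n E F = {P \<in> cont_polys K n E F. (E, F, P) \<in> I}"

definition poly_ideal :: "complex set \<Rightarrow> 'u poly_class \<Rightarrow> bool" where
  "poly_ideal K I \<longleftrightarrow>
     I \<subseteq> {(E, F, P). banach_space K E \<and> banach_space K F \<and> (\<exists>n\<ge>1. P \<in> cont_polys K n E F)} \<and>
     (\<forall>n\<ge>1. \<forall>E F. banach_space K E \<longrightarrow> banach_space K F \<longrightarrow>
        submodule (component K I n E F) (scalar_field K) (poly_space K n E F) \<and>
        finite_type_polys K n E F \<subseteq> component K I n E F) \<and>
     (\<forall>n\<ge>1. \<forall>E F G H.
        banach_space K E \<longrightarrow> banach_space K F \<longrightarrow> banach_space K G \<longrightarrow> banach_space K H \<longrightarrow>
        (\<forall>P \<in> component K I n E F. \<forall>\<phi>1 \<in> lin_ops K G E. \<forall>\<phi>2 \<in> lin_ops K F H.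
           compose (carrier G) \<phi>2 (compose (carrier G) P \<phi>1) \<in> component K I n G H))"

end

theory Submission
  imports Defs
begin

text \<open>
  Let \<open>T \<in> \<L>\<^sub>1(E;F)\<close>.  By Hahn-Banach there are \<open>\<phi> \<in> E'\<close> and \<open>a \<in> E\<close> with \<open>\<phi> a = 1\<close>, unless
  \<open>E = 0\<close>.  By (ii), \<open>P = \<phi>\<^sup>n\<^sup>-\<^sup>1 T\<close> lies in the \<open>n\<close>-th component of the first ideal, hence of the second
  one.  The symmetric mapping of \<open>P\<close> sends \<open>(x, a, \<dots>, a)\<close> to \<open>(T x + (n - 1) \<phi> x T a) / n\<close>, so (i)
  puts \<open>T\<close> plus a rank one operator into the second ideal.
\<close>

section \<open>The Hahn-Banach theorem\<close>

text \<open>Hypothesis (i) speaks of \<open>assoc_multilinear\<close>, a definite description, so it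
  is not enough to write down a symmetric mapping for \<phi>^(n-1) T: the candidate must be shown
  continuous, and every other candidate excluded. Uniqueness concerns values in an arbitrary Banach
  space F; composing with a real functional on F reduces it to real-valued maps, where one-variable
  calculus applies. Hahn-Banach therefore serves twice, on E for \<phi> and on F for uniqueness, and
  both times only a functional that does not vanish at one given vector is wanted. It arises from a
  minimal sublinear functional; all competitors are defined on the whole space, so no partial
  functionals have to be ordered and glued. The coefficients 1/n and (n-1)/n count positions: the
  symmetrisation averages over the n slots that T can occupy, of which one holds x and n-1 hold a.
  The rank one operator is of finite type, so it lies in every ideal and can be subtracted; for E =
  0 the operator T is zero, itself of finite type.\<close>

lemma scalar_field_simps:
  "carrier (scalar_field K) = K" "one (scalar_field K) = 1" "zero (scalar_field K) = 0"
  "add (scalar_field K) = (+)" "monoid.mult (scalar_field K) = (*)"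
  by (simp_all add: scalar_field_def)

lemma scalar_space_simps:
  "carrier (scalar_space K) = K" "zero (scalar_space K) = 0" "add (scalar_space K) = (+)"
  "smult (scalar_space K) = (*)" "nrm (scalar_space K) = cmod"
  by (simp_all add: scalar_space_def)

text \<open>\<open>banach_space\<close> alone allows \<open>K\<close> to be any subring of the
  complex numbers. Sublinear functionals and the derivative argument multiply by reals, and the
  symmetrisation divides by \<open>n\<close>.\<close>

locale rc_banach_space = banach_space +
  assumes real_or_complex: "K = \<real> \<or> K = UNIV"
begin

lemma scalars [simp, intro]:
  "of_real t \<in> K" "of_nat k \<in> K" "0 \<in> K" "1 \<in> K" "-1 \<in> K"
  using real_or_complex by auto

lemma scalars_closed [simp, intro]:
  "c \<in> K \<Longrightarrow> d \<in> K \<Longrightarrow> c + d \<in> K" "c \<in> K \<Longrightarrow> d \<in> K \<Longrightarrow> c - d \<in> K"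
  "c \<in> K \<Longrightarrow> d \<in> K \<Longrightarrow> c * d \<in> K" "c \<in> K \<Longrightarrow> - c \<in> K" "c \<in> K \<Longrightarrow> inverse c \<in> K"
  "c \<in> K \<Longrightarrow> d \<in> K \<Longrightarrow> c / d \<in> K" "c \<in> K \<Longrightarrow> c ^ k \<in> K"
  using real_or_complex by auto

lemma scalars_prod [intro]: "(\<And>i. i \<in> I \<Longrightarrow> c i \<in> K) \<Longrightarrow> (\<Prod>i\<in>I. c i) \<in> K"
  by (induction I rule: infinite_finite_induct) auto

lemmas scale_closed [simp, intro] = smult_closed[unfolded scalar_field_simps]
lemmas scale_add_left = smult_l_distr[unfolded scalar_field_simps]
lemmas scale_add_right = smult_r_distr[unfolded scalar_field_simps]
lemmas scale_scale = smult_assoc1[unfolded scalar_field_simps, symmetric]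
lemmas scale_one [simp] = smult_one[unfolded scalar_field_simps]
lemmas scale_zero_left [simp] = smult_l_null[unfolded scalar_field_simps]
lemmas scale_zero_right [simp] = smult_r_null[unfolded scalar_field_simps]

lemma add_minus_one: "x \<in> carrier E \<Longrightarrow> x \<oplus> (-1) \<odot> x = \<zero>"
  using scale_add_left[of 1 "-1" x] by simp

lemma minus_eq_scale: "x \<in> carrier E \<Longrightarrow> \<ominus> x = (-1) \<odot> x"
  using add_minus_one by (intro M.minus_equality) (auto simp: M.a_comm)

lemma nrm_zero [simp]: "nrm E \<zero> = 0"
  by (simp add: nrm_eq_0_iff)

section \<open>Sublinear functionals dominated by the norm\<close>

definition sublinear :: "('a \<Rightarrow> real) \<Rightarrow> bool" where
  "sublinear q \<longleftrightarrow> q \<in> extensional (carrier E) \<and>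
     (\<forall>x\<in>carrier E. \<forall>y\<in>carrier E. q (x \<oplus> y) \<le> q x + q y) \<and>
     (\<forall>t>0. \<forall>x\<in>carrier E. q (of_real t \<odot> x) \<le> t * q x) \<and>
     (\<forall>x\<in>carrier E. q x \<le> nrm E x)"

lemma sublinearD:
  assumes "sublinear q"
  shows "q \<in> extensional (carrier E)"
    and "x \<in> carrier E \<Longrightarrow> y \<in> carrier E \<Longrightarrow> q (x \<oplus> y) \<le> q x + q y"
    and "t > 0 \<Longrightarrow> x \<in> carrier E \<Longrightarrow> q (of_real t \<odot> x) \<le> t * q x"
    and "x \<in> carrier E \<Longrightarrow> q x \<le> nrm E x"
  using assms by (auto simp: sublinear_def)

lemma sublinear_nrm: "sublinear (restrict (nrm E) (carrier E))"
  by (auto simp: sublinear_def nrm_smult nrm_triangle)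

text \<open>Subadditivity at x and -x gives 0 \<le> q 0 \<le> q x + q (-x), and the norm bounds q
  (-x). The resulting bound by \<open>- nrm E x\<close> is the same for all q, which makes the
  infima over chains finite.\<close>

lemma sublinear_lower_bound:
  assumes q: "sublinear q" and x: "x \<in> carrier E"
  shows "- q ((-1) \<odot> x) \<le> q x" and "0 \<le> q \<zero>" and "- nrm E x \<le> q x"
proof -
  show z: "0 \<le> q \<zero>"
    using sublinearD(2)[OF q, of \<zero> \<zero>] by simp
  have mx: "(-1) \<odot> x \<in> carrier E"
    using x by simp
  show *: "- q ((-1) \<odot> x) \<le> q x"
    using sublinearD(2)[OF q x mx] x z by (simp add: add_minus_one)
  have "nrm E ((-1) \<odot> x) = nrm E x"
    using nrm_smult[of "-1" x] x by simp
  then show "- nrm E x \<le> q x"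
    using * sublinearD(4)[OF q mx] by linarith
qed

text \<open>The definition asks only for \<le>, which infima inherit more easily; the converse is
  the same inequality for the factor 1/t at the vector t x.\<close>

lemma sublinear_scale:
  assumes q: "sublinear q" and x: "x \<in> carrier E" and "t > 0"
  shows "q (of_real t \<odot> x) = t * q x"
proof (rule antisym)
  show "q (of_real t \<odot> x) \<le> t * q x"
    by (rule sublinearD(3)[OF q \<open>t > 0\<close> x])
  have "q (of_real (1 / t) \<odot> (of_real t \<odot> x)) \<le> (1 / t) * q (of_real t \<odot> x)"
    using x \<open>t > 0\<close> by (intro sublinearD(3)[OF q]) auto
  moreover have "of_real (1 / t) \<odot> (of_real t \<odot> x) = (of_real (1 / t) * of_real t) \<odot> x"
    by (rule scale_scale) (use x in auto)
  moreover have "complex_of_real (1 / t) * of_real t = 1"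
    using \<open>t > 0\<close> by (simp flip: of_real_mult)
  ultimately show "t * q x \<le> q (of_real t \<odot> x)"
    using \<open>t > 0\<close> x by (simp add: field_simps)
qed

text \<open>The largest sublinear functional below \<open>q\<close> that is linear in direction \<open>a\<close>, with value \<open>q a\<close>
  at \<open>a\<close>; so a minimal sublinear functional is linear.\<close>

definition linearise :: "('a \<Rightarrow> real) \<Rightarrow> 'a \<Rightarrow> 'a \<Rightarrow> real" where
  "linearise q a = (\<lambda>x\<in>carrier E. INF t\<in>{0..}. q (x \<oplus> of_real t \<odot> a) - t * q a)"

context
  fixes q a
  assumes q: "sublinear q" and a: "a \<in> carrier E"
begin

text \<open>Since t a = (x + t a) + (-x), subadditivity yields the lower bound -q (-x), independent
  of t. Without a lower bound the real infimum would carry no information.\<close>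

lemma linearise_bdd_below:
  assumes x: "x \<in> carrier E"
  shows "bdd_below ((\<lambda>t. q (x \<oplus> of_real t \<odot> a) - t * q a) ` {0..})"
proof (rule bdd_belowI2)
  fix t :: real assume t: "t \<in> {0..}"
  \<comment> \<open>Homogeneity covers only t > 0; at t = 0 the inequality is 0 \<le> q 0.\<close>
  have ta: "t * q a \<le> q (of_real t \<odot> a)"
  proof (cases "t = 0")
    case True
    then show ?thesis using sublinear_lower_bound(2)[OF q a] a by simp
  next
    case False
    then show ?thesis using sublinear_scale[OF q a, of t] t by simp
  qed
  have "of_real t \<odot> a = (x \<oplus> of_real t \<odot> a) \<oplus> (-1) \<odot> x"
    using x a add_minus_one[OF x] M.a_assoc[of x "(-1) \<odot> x" "of_real t \<odot> a"]
    by (simp add: M.a_ac)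
  then have "q (of_real t \<odot> a) \<le> q (x \<oplus> of_real t \<odot> a) + q ((-1) \<odot> x)"
    using sublinearD(2)[OF q, of "x \<oplus> of_real t \<odot> a" "(-1) \<odot> x"] x a by simp
  then show "- q ((-1) \<odot> x) \<le> q (x \<oplus> of_real t \<odot> a) - t * q a"
    using ta by simp
qed

lemma linearise_le:
  assumes "x \<in> carrier E" "t \<ge> 0"
  shows "linearise q a x \<le> q (x \<oplus> of_real t \<odot> a) - t * q a"
  using assms linearise_bdd_below[OF assms(1)] by (auto simp: linearise_def intro: cINF_lower)

lemma le_linearise:
  assumes "x \<in> carrier E" "\<And>t. t \<ge> 0 \<Longrightarrow> r \<le> q (x \<oplus> of_real t \<odot> a) - t * q a"
  shows "r \<le> linearise q a x"
  using assms by (auto simp: linearise_def intro!: cINF_greatest)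

lemma linearise_le_self:
  assumes "x \<in> carrier E"
  shows "linearise q a x \<le> q x"
  using linearise_le[OF assms, of 0] assms a by simp

text \<open>Parameters combine well: s for x and t for y give s + t for x + y, and t for x gives s t
  for s x. So any values of the defining expressions on the right dominate one on the left, and
  infima may be taken one variable at a time.\<close>

lemma sublinear_linearise: "sublinear (linearise q a)"
  unfolding sublinear_def
proof (intro conjI ballI allI impI)
  show "linearise q a \<in> extensional (carrier E)"
    by (simp add: linearise_def)
next
  fix x y assume xy: "x \<in> carrier E" "y \<in> carrier E"
  have *: "linearise q a (x \<oplus> y) \<le> (q (x \<oplus> of_real s \<odot> a) - s * q a) + (q (y \<oplus> of_real t \<odot> a) - t * q a)"
    if "s \<ge> 0" "t \<ge> 0" for s t
  proof -
    have "linearise q a (x \<oplus> y) \<le> q ((x \<oplus> y) \<oplus> of_real (s + t) \<odot> a) - (s + t) * q a"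
      using xy that by (intro linearise_le) auto
    also have "(x \<oplus> y) \<oplus> of_real (s + t) \<odot> a = (x \<oplus> of_real s \<odot> a) \<oplus> (y \<oplus> of_real t \<odot> a)"
      using xy a by (simp add: scale_add_left M.a_ac)
    also have "q \<dots> \<le> q (x \<oplus> of_real s \<odot> a) + q (y \<oplus> of_real t \<odot> a)"
      using xy a by (intro sublinearD(2)[OF q]) auto
    finally show ?thesis
      by (simp add: algebra_simps)
  qed
  have "linearise q a (x \<oplus> y) - (q (x \<oplus> of_real s \<odot> a) - s * q a) \<le> linearise q a y" if "s \<ge> 0" for s
    using *[OF that] xy by (intro le_linearise) (auto simp: algebra_simps)
  then have "linearise q a (x \<oplus> y) - linearise q a y \<le> linearise q a x"
    using xy by (intro le_linearise) (auto simp: algebra_simps)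
  then show "linearise q a (x \<oplus> y) \<le> linearise q a x + linearise q a y"
    by simp
next
  fix s :: real and x assume s: "s > 0" and x: "x \<in> carrier E"
  have "linearise q a (of_real s \<odot> x) / s \<le> q (x \<oplus> of_real t \<odot> a) - t * q a" if "t \<ge> 0" for t
  proof -
    have "linearise q a (of_real s \<odot> x) \<le> q (of_real s \<odot> x \<oplus> of_real (s * t) \<odot> a) - (s * t) * q a"
      using x s that by (intro linearise_le) auto
    also have "of_real s \<odot> x \<oplus> of_real (s * t) \<odot> a = of_real s \<odot> (x \<oplus> of_real t \<odot> a)"
      using x a by (simp add: scale_add_right scale_scale)
    also have "q \<dots> \<le> s * q (x \<oplus> of_real t \<odot> a)"
      using x a s by (intro sublinearD(3)[OF q]) auto
    finally show ?thesis
      using s by (simp add: field_simps)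
  qed
  then have "linearise q a (of_real s \<odot> x) / s \<le> linearise q a x"
    using x by (intro le_linearise) auto
  then show "linearise q a (of_real s \<odot> x) \<le> s * linearise q a x"
    using s by (simp add: field_simps)
next
  fix x assume x: "x \<in> carrier E"
  then show "linearise q a x \<le> nrm E x"
    using linearise_le_self[OF x] sublinearD(4)[OF q x] by simp
qed

end

section \<open>Infima of chains and minimal sublinear functionals\<close>

lemma sublinear_INF_chain:
  assumes C: "C \<noteq> {}" "\<And>q. q \<in> C \<Longrightarrow> sublinear q"
    and chain: "\<And>q r. q \<in> C \<Longrightarrow> r \<in> C \<Longrightarrow>
      (\<forall>x\<in>carrier E. q x \<le> r x) \<or> (\<forall>x\<in>carrier E. r x \<le> q x)"
  defines "u \<equiv> \<lambda>x\<in>carrier E. INF q\<in>C. q x"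
  shows "sublinear u" and "q \<in> C \<Longrightarrow> x \<in> carrier E \<Longrightarrow> u x \<le> q x"
proof -
  have bdd: "bdd_below ((\<lambda>q. q x) ` C)" if "x \<in> carrier E" for x
    using C sublinear_lower_bound(3) that by (intro bdd_belowI2[of _ "- nrm E x"]) auto
  show le: "u x \<le> q x" if "q \<in> C" "x \<in> carrier E" for q x
    using that bdd unfolding u_def by (auto intro: cINF_lower)
  have ge: "r \<le> u x" if "x \<in> carrier E" "\<And>q. q \<in> C \<Longrightarrow> r \<le> q x" for r x
    using that C unfolding u_def by (auto intro: cINF_greatest)
  show "sublinear u"
    unfolding sublinear_def
  proof (intro conjI ballI allI impI)
    show "u \<in> extensional (carrier E)"
      by (simp add: u_def)
  next
    fix x y assume xy: "x \<in> carrier E" "y \<in> carrier E"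
    \<comment> \<open>This is where the chain condition enters: the smaller of q and r is one
      subadditive functional below both. For unrelated functionals the pointwise infimum may fail to
      be subadditive.\<close>
    have *: "u (x \<oplus> y) \<le> q x + r y" if qr: "q \<in> C" "r \<in> C" for q r
    proof -
      obtain s where s: "s \<in> C" "\<And>z. z \<in> carrier E \<Longrightarrow> s z \<le> q z" "\<And>z. z \<in> carrier E \<Longrightarrow> s z \<le> r z"
        using chain[OF qr] qr by (metis order_refl)
      have "u (x \<oplus> y) \<le> s (x \<oplus> y)"
        using le s xy by simp
      also have "\<dots> \<le> s x + s y"
        using sublinearD(2) C(2) s xy by blast
      finally show ?thesis
        using s(2)[OF xy(1)] s(3)[OF xy(2)] by simp
    qed
    have "u (x \<oplus> y) - q x \<le> u y" if "q \<in> C" for q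
      using *[OF that] xy by (intro ge) (auto simp: algebra_simps)
    then have "u (x \<oplus> y) - u y \<le> u x"
      using xy by (intro ge) (auto simp: algebra_simps)
    then show "u (x \<oplus> y) \<le> u x + u y"
      by simp
  next
    fix t :: real and x assume t: "t > 0" and x: "x \<in> carrier E"
    have "u (of_real t \<odot> x) / t \<le> q x" if q: "q \<in> C" for q
    proof -
      have "u (of_real t \<odot> x) \<le> q (of_real t \<odot> x)"
        using le q x by simp
      also have "\<dots> \<le> t * q x"
        using sublinearD(3) C(2) q x t by blast
      finally show ?thesis
        using t by (simp add: field_simps)
    qed
    then have "u (of_real t \<odot> x) / t \<le> u x"
      using x by (intro ge)
    then show "u (of_real t \<odot> x) \<le> t * u x"
      using t by (simp add: field_simps)
  next
    fix x assume x: "x \<in> carrier E"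
    obtain q where "q \<in> C" using C by auto
    then show "u x \<le> nrm E x"
      using le[of q x] x sublinearD(4) C(2) by (meson order_trans)
  qed
qed

lemma exists_minimal_sublinear:
  assumes p: "sublinear p"
  obtains m where "sublinear m" "\<And>x. x \<in> carrier E \<Longrightarrow> m x \<le> p x"
    "\<And>q. sublinear q \<Longrightarrow> (\<And>x. x \<in> carrier E \<Longrightarrow> q x \<le> m x) \<Longrightarrow> q = m"
proof -
  define A where "A = {q. sublinear q \<and> (\<forall>x\<in>carrier E. q x \<le> p x)}"
  \<comment> \<open>The pointwise order is reversed, so that the maximal element given by Zorn's
    lemma is a minimal functional.\<close>
  define R where "R q r \<longleftrightarrow> (\<forall>x\<in>carrier E. r x \<le> q x)" for q r :: "'a \<Rightarrow> real"
  have "\<exists>m\<in>A. \<forall>q\<in>A. R m q \<longrightarrow> q = m"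
  proof (rule predicate_Zorn)
    show "partial_order_on A (relation_of R A)"
    proof (rule partial_order_on_relation_ofI)
      fix q assume "q \<in> A" then show "R q q" by (simp add: R_def)
    next
      fix q r s assume "R q r" "R r s" then show "R q s" unfolding R_def by (meson order_trans)
    next
      \<comment> \<open>Antisymmetry is the reason for extensionality in \<open>sublinear\<close>:
        \<open>R\<close> compares values on the carrier only.\<close>
      fix q r assume "q \<in> A" "r \<in> A" "R q r" "R r q"
      then show "q = r"
        unfolding R_def A_def
        by (intro extensionalityI[of q "carrier E" r]) (auto dest: sublinearD(1) intro: antisym)
    qed
  next
    fix C assume C: "C \<in> Chains (relation_of R A)"
    then have CA: "C \<subseteq> A" and ch: "\<And>q r. q \<in> C \<Longrightarrow> r \<in> C \<Longrightarrow> R q r \<or> R r q"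
      unfolding Chains_def relation_of_def by auto
    show "\<exists>u\<in>A. \<forall>q\<in>C. R q u"
    \<comment> \<open>The infimum over the empty chain is meaningless, so \<open>p\<close> itself
      serves as the bound there.\<close>
    proof (cases "C = {}")
      case True
      then show ?thesis using p by (auto simp: A_def)
    next
      case False
      let ?u = "\<lambda>x\<in>carrier E. INF q\<in>C. q x"
      have sC: "\<And>q. q \<in> C \<Longrightarrow> sublinear q"
        and c: "\<And>q r. q \<in> C \<Longrightarrow> r \<in> C \<Longrightarrow> (\<forall>x\<in>carrier E. q x \<le> r x) \<or> (\<forall>x\<in>carrier E. r x \<le> q x)"
        using CA ch unfolding A_def R_def by blast+
      have u: "sublinear ?u"
        by (rule sublinear_INF_chain(1)[OF False]) (erule sC, rule c)
      have u_le: "\<And>q x. q \<in> C \<Longrightarrow> x \<in> carrier E \<Longrightarrow> ?u x \<le> q x"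
        by (rule sublinear_INF_chain(2)[OF False]) (erule sC, rule c)
      obtain q where q: "q \<in> C" using False by auto
      have "?u x \<le> p x" if "x \<in> carrier E" for x
      proof -
        have "q x \<le> p x"
          using q CA that by (auto simp: A_def)
        then show ?thesis
          using u_le[OF q that] by linarith
      qed
      then have "?u \<in> A"
        using u unfolding A_def by blast
      moreover have "R q ?u" if "q \<in> C" for q
        unfolding R_def using u_le[OF that] by blast
      ultimately show ?thesis by blast
    qed
  qed
  then obtain m where m: "m \<in> A" "\<And>q. q \<in> A \<Longrightarrow> R m q \<Longrightarrow> q = m"
    by blast
  show thesis
  proof (rule that)
    show "sublinear m" "\<And>x. x \<in> carrier E \<Longrightarrow> m x \<le> p x"
      using m(1) by (auto simp: A_def)
    fix q assume "sublinear q" and *: "\<And>x. x \<in> carrier E \<Longrightarrow> q x \<le> m x"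
    then show "q = m"
      using m unfolding A_def R_def by (smt (verit, best) mem_Collect_eq)
  qed
qed

section \<open>Real functionals from minimal sublinear ones\<close>

definition real_functional :: "('a \<Rightarrow> real) \<Rightarrow> bool" where
  "real_functional f \<longleftrightarrow>
     (\<forall>x\<in>carrier E. \<forall>y\<in>carrier E. f (x \<oplus> y) = f x + f y) \<and>
     (\<forall>t. \<forall>x\<in>carrier E. f (of_real t \<odot> x) = t * f x) \<and>
     (\<forall>x\<in>carrier E. \<bar>f x\<bar> \<le> nrm E x)"

text \<open>By minimality \<open>linearise m y\<close> coincides with \<open>m\<close>, and its
  defining infimum at t = 1 reads m x \<le> m (x + y) - m y, the missing half of additivity.
  Negative scalars then follow from additivity and positive ones from
  \<open>sublinear_scale\<close>.\<close>

lemma minimal_sublinear_imp_functional: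
  assumes m: "sublinear m"
    and min: "\<And>q. sublinear q \<Longrightarrow> (\<And>x. x \<in> carrier E \<Longrightarrow> q x \<le> m x) \<Longrightarrow> q = m"
  shows "real_functional m"
proof -
  have add: "m (x \<oplus> y) = m x + m y" if xy: "x \<in> carrier E" "y \<in> carrier E" for x y
  proof (rule antisym)
    show "m (x \<oplus> y) \<le> m x + m y"
      using sublinearD(2)[OF m] xy by blast
    have "linearise m y = m"
      using m xy by (intro min sublinear_linearise linearise_le_self) auto
    then show "m x + m y \<le> m (x \<oplus> y)"
      using linearise_le[OF m xy(2,1), of 1] xy by simp
  qed
  have z: "m \<zero> = 0"
    using add[of \<zero> \<zero>] by simp
  have neg: "m ((-1) \<odot> x) = - m x" if "x \<in> carrier E" for x
    using add[of x "(-1) \<odot> x"] that z by (simp add: add_minus_one)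
  have scale: "m (of_real t \<odot> x) = t * m x" if x: "x \<in> carrier E" for t x
  proof -
    consider "t = 0" | "t > 0" | "t < 0" by linarith
    then show ?thesis
    proof cases
      case 3
      have "of_real t \<odot> x = (-1) \<odot> (of_real (- t) \<odot> x)"
        using scale_scale[of "-1" "of_real (- t)" x] x scalars(1)[of "-t"] by simp
      then show ?thesis
        using neg[of "of_real (- t) \<odot> x"] sublinear_scale[OF m x, of "-t"] 3 x by simp
    qed (use z x sublinear_scale[OF m x] in simp_all)
  qed
  have "\<bar>m x\<bar> \<le> nrm E x" if "x \<in> carrier E" for x
    using sublinearD(4)[OF m that] sublinear_lower_bound(3)[OF m that] by linarith
  then show ?thesis
    using add scale by (auto simp: real_functional_def)
qed

text \<open>A minimal functional below the norm alone could vanish at a, so the search starts below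
  the norm linearised in direction a. At -a with t = 1 this gives m (-a) \<le> nrm 0 - nrm a, hence
  m a \<ge> nrm a > 0.\<close>

lemma hahn_banach:
  assumes a: "a \<in> carrier E" "a \<noteq> \<zero>"
  obtains f where "real_functional f" "f a > 0"
proof -
  let ?n = "restrict (nrm E) (carrier E)"
  obtain m where m: "sublinear m" "\<And>x. x \<in> carrier E \<Longrightarrow> m x \<le> linearise ?n a x"
    "\<And>q. sublinear q \<Longrightarrow> (\<And>x. x \<in> carrier E \<Longrightarrow> q x \<le> m x) \<Longrightarrow> q = m"
    using exists_minimal_sublinear[OF sublinear_linearise[OF sublinear_nrm a(1)]] by blast
  have rf: "real_functional m"
    using minimal_sublinear_imp_functional m by blast
  have na: "(-1) \<odot> a \<in> carrier E"
    using a by simp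
  have "m ((-1) \<odot> a) \<le> linearise ?n a ((-1) \<odot> a)"
    by (rule m(2)[OF na])
  also have "\<dots> \<le> ?n ((-1) \<odot> a \<oplus> of_real 1 \<odot> a) - 1 * ?n a"
    by (rule linearise_le[OF sublinear_nrm a(1) na]) simp
  also have "(-1) \<odot> a \<oplus> of_real 1 \<odot> a = \<zero>"
    using a add_minus_one[OF a(1)] by (simp add: M.a_comm)
  finally have "m ((-1) \<odot> a) \<le> - nrm E a"
    using a by simp
  moreover have "m ((-1) \<odot> a) = - m a"
    using rf a unfolding real_functional_def by (metis mult_minus1 of_real_1 of_real_minus)
  moreover have "nrm E a > 0"
    using a nrm_nonneg[of a] nrm_eq_0_iff[of a] by linarith
  ultimately show thesis
    using rf by (intro that[of m]) auto
qed

end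


section \<open>Limits and scalar functionals\<close>

lemma (in banach_space) topspace_ntop [simp]: "topspace (ntop E) = carrier E"
proof -
  interpret Metric_space "carrier E" "ndist E" by (rule metric_space)
  show ?thesis by (simp add: ntop_def)
qed

text \<open>Turns topological limits into limits of real norms. As \<open>ndist\<close> is 0 off the
  carrier, small distance alone says nothing there, and eventual membership is a condition of its
  own.\<close>

lemma (in banach_space) limitin_ntop:
  "limitin (ntop E) g l Fl \<longleftrightarrow> l \<in> carrier E \<and> (\<forall>\<^sub>F x in Fl. g x \<in> carrier E) \<and>
     ((\<lambda>x. nrm E (g x \<ominus> l)) \<longlongrightarrow> 0) Fl"
proof -
  interpret Metric_space "carrier E" "ndist E" by (rule metric_space)
  have "limitin (ntop E) g l Fl \<longleftrightarrow>
      l \<in> carrier E \<and> (\<forall>e>0. \<forall>\<^sub>F x in Fl. g x \<in> carrier E \<and> ndist E (g x) l < e)"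
    by (simp add: ntop_def limitin_metric)
  also have "\<dots> \<longleftrightarrow> l \<in> carrier E \<and> (\<forall>\<^sub>F x in Fl. g x \<in> carrier E) \<and>
      (\<forall>e>0. \<forall>\<^sub>F x in Fl. g x \<in> carrier E \<and> ndist E (g x) l < e)"
    by (auto dest: spec[of _ 1] elim: eventually_mono)
  also have "\<dots> \<longleftrightarrow> l \<in> carrier E \<and> (\<forall>\<^sub>F x in Fl. g x \<in> carrier E) \<and>
      ((\<lambda>x. nrm E (g x \<ominus> l)) \<longlongrightarrow> 0) Fl"
  proof (intro conj_cong refl)
    assume l: "l \<in> carrier E" and g: "\<forall>\<^sub>F x in Fl. g x \<in> carrier E"
    have "(\<forall>\<^sub>F x in Fl. g x \<in> carrier E \<and> ndist E (g x) l < e) \<longleftrightarrow>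
        (\<forall>\<^sub>F x in Fl. dist (nrm E (g x \<ominus> l)) 0 < e)" for e
      using g by (intro eventually_cong[OF g]) (auto simp: ndist_def l nrm_nonneg)
    then show "(\<forall>e>0. \<forall>\<^sub>F x in Fl. g x \<in> carrier E \<and> ndist E (g x) l < e) \<longleftrightarrow>
        ((\<lambda>x. nrm E (g x \<ominus> l)) \<longlongrightarrow> 0) Fl"
      by (simp add: tendsto_iff)
  qed
  finally show ?thesis .
qed

context rc_banach_space
begin

lemma rc_scalar_space: "rc_banach_space K (scalar_space K)"
  using banach_scalar_space[OF real_or_complex] real_or_complex
  by (simp add: rc_banach_space_def rc_banach_space_axioms_def)

lemma limitin_scalar_space:
  "limitin (ntop (scalar_space K)) g l Fl \<longleftrightarrow> l \<in> K \<and> (\<forall>\<^sub>F x in Fl. g x \<in> K) \<and> (g \<longlongrightarrow> l) Fl"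
proof -
  interpret S: rc_banach_space K "scalar_space K" by (rule rc_scalar_space)
  have "((\<lambda>x. nrm (scalar_space K) (g x \<ominus>\<^bsub>scalar_space K\<^esub> l)) \<longlongrightarrow> 0) Fl \<longleftrightarrow> (g \<longlongrightarrow> l) Fl"
    if l: "l \<in> K" and g: "\<forall>\<^sub>F x in Fl. g x \<in> K"
  proof -
    have "\<ominus>\<^bsub>scalar_space K\<^esub> l = - l"
      using S.minus_eq_scale[of l] l by (simp add: scalar_space_simps)
    then have "nrm (scalar_space K) (g x \<ominus>\<^bsub>scalar_space K\<^esub> l) = norm (g x - l)" for x
      by (simp add: a_minus_def scalar_space_simps)
    then show ?thesis
      by (simp only: tendsto_norm_zero_iff LIM_zero_iff[of g])
  qed
  then show ?thesis
    unfolding S.limitin_ntop scalar_space_simps by blast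
qed

section \<open>Continuous scalar functionals\<close>

lemma lin_ops_scalarI:
  assumes add: "\<And>x y. x \<in> carrier E \<Longrightarrow> y \<in> carrier E \<Longrightarrow> \<phi> (x \<oplus> y) = \<phi> x + \<phi> y"
    and scale: "\<And>c x. c \<in> K \<Longrightarrow> x \<in> carrier E \<Longrightarrow> \<phi> (c \<odot> x) = c * \<phi> x"
    and closed: "\<And>x. x \<in> carrier E \<Longrightarrow> \<phi> x \<in> K"
    and bound: "\<And>x. x \<in> carrier E \<Longrightarrow> cmod (\<phi> x) \<le> B * nrm E x"
  shows "restrict \<phi> (carrier E) \<in> lin_ops K E (scalar_space K)"
proof -
  have "continuous_map (ntop E) (ntop (scalar_space K)) (restrict \<phi> (carrier E))"
    unfolding continuous_map_atin
  proof
    fix x assume "x \<in> topspace (ntop E)"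
    then have x: "x \<in> carrier E" by simp
    have "limitin (ntop E) (\<lambda>y. y) x (atin (ntop E) x)"
      using x continuous_map_id[of "ntop E", unfolded continuous_map_atin id_def] by simp
    then have lim: "\<forall>\<^sub>F y in atin (ntop E) x. y \<in> carrier E"
        "((\<lambda>y. nrm E (y \<ominus> x)) \<longlongrightarrow> 0) (atin (ntop E) x)"
      by (simp_all add: limitin_ntop)
    let ?f = "restrict \<phi> (carrier E)"
    \<comment> \<open>Linearity turns the bound into a Lipschitz estimate with the same
      constant.\<close>
    have diff: "cmod (?f y - ?f x) \<le> B * nrm E (y \<ominus> x)" if "y \<in> carrier E" for y
    proof -
      have "\<phi> (y \<ominus> x) = \<phi> y - \<phi> x"
        using that x by (simp add: a_minus_def minus_eq_scale add scale)
      then show ?thesis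
        using bound[of "y \<ominus> x"] that x by simp
    qed
    have "((\<lambda>y. ?f y - ?f x) \<longlongrightarrow> 0) (atin (ntop E) x)"
    proof (rule Lim_null_comparison)
      show "\<forall>\<^sub>F y in atin (ntop E) x. norm (?f y - ?f x) \<le> B * nrm E (y \<ominus> x)"
        using lim(1) diff by (rule eventually_mono)
      show "((\<lambda>y. B * nrm E (y \<ominus> x)) \<longlongrightarrow> 0) (atin (ntop E) x)"
        using tendsto_mult_left[OF lim(2), of B] by simp
    qed
    then have "(?f \<longlongrightarrow> ?f x) (atin (ntop E) x)"
      by (rule LIM_zero_cancel)
    moreover have "\<forall>\<^sub>F y in atin (ntop E) x. ?f y \<in> K"
      using lim(1) by (rule eventually_mono) (simp add: closed)
    ultimately show "limitin (ntop (scalar_space K)) ?f (?f x) (atin (ntop E) x)"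
      unfolding limitin_scalar_space using x closed by simp
  qed
  then show ?thesis
    unfolding lin_ops_def mem_Collect_eq scalar_space_simps
    by (intro conjI ballI) (simp_all add: add scale closed)
qed

lemma exists_scalar_functional:
  assumes a: "a \<in> carrier E" "a \<noteq> \<zero>"
  obtains \<phi> where "\<phi> \<in> lin_ops K E (scalar_space K)" "\<phi> a = 1"
proof -
  obtain f where f: "real_functional f" and fa: "f a > 0"
    using hahn_banach[OF a] .
  have fD: "\<And>x y. x \<in> carrier E \<Longrightarrow> y \<in> carrier E \<Longrightarrow> f (x \<oplus> y) = f x + f y"
    "\<And>t x. x \<in> carrier E \<Longrightarrow> f (of_real t \<odot> x) = t * f x"
    "\<And>x. x \<in> carrier E \<Longrightarrow> \<bar>f x\<bar> \<le> nrm E x"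
    using f unfolding real_functional_def by blast+
  obtain \<phi> where \<phi>: "\<And>x y. x \<in> carrier E \<Longrightarrow> y \<in> carrier E \<Longrightarrow> \<phi> (x \<oplus> y) = \<phi> x + \<phi> y"
    "\<And>c x. c \<in> K \<Longrightarrow> x \<in> carrier E \<Longrightarrow> \<phi> (c \<odot> x) = c * \<phi> x"
    "\<And>x. x \<in> carrier E \<Longrightarrow> \<phi> x \<in> K" "\<And>x. x \<in> carrier E \<Longrightarrow> cmod (\<phi> x) \<le> 2 * nrm E x"
    "\<phi> a \<noteq> 0"
  proof (cases "K = UNIV")
    case True
    \<comment> \<open>The usual complexification x \<mapsto> f x - i f (i x): it is complex linear,
      and its real part f keeps it nonzero at a. The factor 2 in the bound is the crude sum of the
      bounds for f x and f (i x), which is enough for continuity.\<close>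
    let ?\<phi> = "\<lambda>x. Complex (f x) (- f (\<i> \<odot> x))"
    have "?\<phi> (c \<odot> x) = c * ?\<phi> x" if x: "x \<in> carrier E" for c x
    proof -
      have ix: "\<i> \<odot> x \<in> carrier E" using x True by simp
      have c: "c = of_real (Re c) + of_real (Im c) * \<i>"
        by (simp add: complex_eq_iff)
      have "c \<odot> x = of_real (Re c) \<odot> x \<oplus> of_real (Im c) \<odot> (\<i> \<odot> x)"
        by (subst c) (use x True in \<open>simp add: scale_add_left scale_scale\<close>)
      then have 1: "f (c \<odot> x) = Re c * f x + Im c * f (\<i> \<odot> x)"
        using x ix by (simp add: fD)
      have ic: "\<i> * c = of_real (Re c) * \<i> + of_real (- Im c)"
        by (simp add: complex_eq_iff)
      have "\<i> \<odot> (c \<odot> x) = (\<i> * c) \<odot> x"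
        using x True by (simp add: scale_scale)
      also have "\<dots> = of_real (Re c) \<odot> (\<i> \<odot> x) \<oplus> of_real (- Im c) \<odot> x"
        unfolding ic using x True by (simp add: scale_add_left scale_scale del: of_real_minus)
      finally have 2: "f (\<i> \<odot> (c \<odot> x)) = Re c * f (\<i> \<odot> x) - Im c * f x"
        using x ix scalars(1) by (simp add: fD del: of_real_minus)
      show ?thesis
        unfolding 1 2 by (simp add: complex_eq_iff algebra_simps)
    qed
    moreover have "cmod (?\<phi> x) \<le> 2 * nrm E x" if x: "x \<in> carrier E" for x
    proof -
      have ix: "\<i> \<odot> x \<in> carrier E" using x True by simp
      have "cmod (?\<phi> x) \<le> \<bar>f x\<bar> + \<bar>f (\<i> \<odot> x)\<bar>"
        using cmod_le[of "?\<phi> x"] by simp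
      also have "\<dots> \<le> nrm E x + nrm E (\<i> \<odot> x)"
        using fD(3)[OF x] fD(3)[OF ix] by simp
      finally show ?thesis
        using x True by (simp add: nrm_smult)
    qed
    moreover have "?\<phi> a \<noteq> 0"
      using fa by (simp add: complex_eq_iff)
    moreover have "?\<phi> (x \<oplus> y) = ?\<phi> x + ?\<phi> y" if "x \<in> carrier E" "y \<in> carrier E" for x y
      using that True by (simp add: fD complex_eq_iff scale_add_right)
    ultimately show thesis
      using True by (intro that[of ?\<phi>]) simp_all
  next
    case False
    then have K: "K = \<real>" using real_or_complex by simp
    have "cmod (of_real (f x)) \<le> 2 * nrm E x" if "x \<in> carrier E" for x
      using fD(3)[OF that] by simp
    moreover have "complex_of_real (f (c \<odot> x)) = c * of_real (f x)" if "c \<in> K" "x \<in> carrier E" for c x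
      using that unfolding K by (elim Reals_cases) (simp add: fD(2))
    ultimately show thesis
      using fa by (intro that[of "\<lambda>x. complex_of_real (f x)"]) (simp_all add: K fD(1))
  qed
  \<comment> \<open>Division by \<phi> a and not by f a: in the complex case \<phi> a may have an
    imaginary part.\<close>
  let ?\<psi> = "\<lambda>x. inverse (\<phi> a) * \<phi> x"
  have "restrict ?\<psi> (carrier E) \<in> lin_ops K E (scalar_space K)"
  proof (rule lin_ops_scalarI[where B = "cmod (inverse (\<phi> a)) * 2"])
    fix x assume x: "x \<in> carrier E"
    show "cmod (?\<psi> x) \<le> cmod (inverse (\<phi> a)) * 2 * nrm E x"
      using mult_left_mono[OF \<phi>(4)[OF x], of "cmod (inverse (\<phi> a))"] by (simp add: norm_mult)
  qed (use \<phi> a in \<open>auto simp: algebra_simps\<close>)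
  then show thesis
    using that[of "restrict ?\<psi> (carrier E)"] a \<phi>(5) by simp
qed

end

section \<open>Uniqueness of the symmetric multilinear mapping\<close>

context rc_banach_space
begin

text \<open>Differentiating \<open>t \<mapsto> D (u + t w)\<close> at \<open>0\<close> replaces the polarization formula.\<close>

context
  fixes n :: nat and D :: "(nat \<Rightarrow> 'a) \<Rightarrow> real"
  assumes add: "\<And>x i u v. x \<in> {..<n} \<rightarrow>\<^sub>E carrier E \<Longrightarrow> i < n \<Longrightarrow> u \<in> carrier E \<Longrightarrow> v \<in> carrier E \<Longrightarrow>
      D (x(i := u \<oplus> v)) = D (x(i := u)) + D (x(i := v))"
    and scale: "\<And>x i t u. x \<in> {..<n} \<rightarrow>\<^sub>E carrier E \<Longrightarrow> i < n \<Longrightarrow> u \<in> carrier E \<Longrightarrow>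
      D (x(i := of_real t \<odot> u)) = t * D (x(i := u))"
begin

text \<open>Induction over the set \<open>J\<close> of moving slots. Linearity in a new slot j
  splits the map into the old one and t times the old one with w j in slot j; hence the base tuple u
  must stay arbitrary.\<close>

lemma multilinear_has_derivative:
  assumes "J \<subseteq> {..<n}" and "u \<in> {..<n} \<rightarrow>\<^sub>E carrier E" and w: "w \<in> {..<n} \<rightarrow> carrier E"
  shows "((\<lambda>t. D (\<lambda>i. if i \<in> J then u i \<oplus> of_real t \<odot> w i else u i)) has_field_derivative
           (\<Sum>i\<in>J. D (u(i := w i)))) (at 0)"
proof -
  have "finite J" using assms(1) finite_subset by blast
  then show ?thesis
    using assms(1,2)
  proof (induction J arbitrary: u rule: finite_induct)
    case (insert j J)
    then have j: "j < n" and J: "J \<subseteq> {..<n}" and u: "u \<in> {..<n} \<rightarrow>\<^sub>E carrier E"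
      by auto
    have wc: "w i \<in> carrier E" if "i < n" for i
      using w that by auto
    have uc: "u i \<in> carrier E" if "i < n" for i
      using u that by auto
    have uj: "u(j := w j) \<in> {..<n} \<rightarrow>\<^sub>E carrier E"
      using u j wc by (auto simp: PiE_iff extensional_def)
    let ?h = "\<lambda>u t. D (\<lambda>i. if i \<in> J then u i \<oplus> of_real t \<odot> w i else u i)"
    have h: "D (\<lambda>i. if i \<in> insert j J then u i \<oplus> of_real t \<odot> w i else u i) =
        ?h u t + t * ?h (u(j := w j)) t" for t
    proof -
      let ?y = "\<lambda>i. if i \<in> J then u i \<oplus> of_real t \<odot> w i else u i"
      have y: "?y \<in> {..<n} \<rightarrow>\<^sub>E carrier E"
        using u J uc wc by (auto simp: PiE_iff extensional_def)
      have "(\<lambda>i. if i \<in> insert j J then u i \<oplus> of_real t \<odot> w i else u i) =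
          ?y(j := u j \<oplus> of_real t \<odot> w j)"
        by (auto simp: fun_eq_iff)
      moreover have "?y(j := u j) = ?y"
        using insert(2) by (auto simp: fun_eq_iff)
      moreover have "?y(j := w j) =
          (\<lambda>i. if i \<in> J then (u(j := w j)) i \<oplus> of_real t \<odot> w i else (u(j := w j)) i)"
        using insert(2) by (auto simp: fun_eq_iff)
      ultimately show ?thesis
        using add[OF y j, of "u j" "of_real t \<odot> w j"] scale[OF y j, of "w j" t] uc wc j by simp
    qed
    have zero: "(\<lambda>i. if i \<in> J then (u(j := w j)) i \<oplus> of_real 0 \<odot> w i else (u(j := w j)) i) = u(j := w j)"
      using J uc wc by (auto simp: fun_eq_iff)
    \<comment> \<open>By the product rule at t = 0, the derivative of the second factor is
      multiplied by 0 and only its value D (u(j := w j)) remains: the summand for j.\<close>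
    have "((\<lambda>t. ?h u t + t * ?h (u(j := w j)) t) has_field_derivative
        (\<Sum>i\<in>J. D (u(i := w i))) + (1 * ?h (u(j := w j)) 0 + (\<Sum>i\<in>J. D ((u(j := w j))(i := w i))) * 0)) (at 0)"
      by (intro DERIV_add DERIV_mult DERIV_ident insert.IH J u uj)
    moreover have "(\<Sum>i\<in>J. D (u(i := w i))) +
        (1 * ?h (u(j := w j)) 0 + (\<Sum>i\<in>J. D ((u(j := w j))(i := w i))) * 0) =
        (\<Sum>i\<in>insert j J. D (u(i := w i)))"
      unfolding zero using insert(1,2) by simp
    moreover have "(\<lambda>t. D (\<lambda>i. if i \<in> insert j J then u i \<oplus> of_real t \<odot> w i else u i)) =
        (\<lambda>t. ?h u t + t * ?h (u(j := w j)) t)"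
      by (rule ext) (rule h)
    ultimately show ?case
      by metis
  qed simp
qed

text \<open>Induction on the number k of leading entries that are free, the others being a common y.
  Moving y in direction x k differentiates the zero function; by symmetry the n - k resulting terms
  are equal, so each vanishes, and one of them has k + 1 free entries.\<close>

lemma symmetric_multilinear_eq_0:
  assumes sym: "symmetric_map n E D"
    and diag: "\<And>y. y \<in> carrier E \<Longrightarrow> D (\<lambda>i\<in>{..<n}. y) = 0"
    and x: "x \<in> {..<n} \<rightarrow>\<^sub>E carrier E"
  shows "D x = 0"
proof -
  have xc: "x i \<in> carrier E" if "i < n" for i
    using x that by auto
  have "\<forall>y\<in>carrier E. D (\<lambda>i\<in>{..<n}. if i < k then x i else y) = 0" if "k \<le> n" for k
    using that
  proof (induction k)
    case 0
    then show ?case using diag by (simp add: restrict_def)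
  next
    case (Suc k)
    then have k: "k < n" by simp
    show ?case
    proof
      fix y assume y: "y \<in> carrier E"
      let ?u = "\<lambda>i\<in>{..<n}. if i < k then x i else y"
      have u: "?u \<in> {..<n} \<rightarrow>\<^sub>E carrier E"
        using y xc by (auto simp: PiE_iff)
      have eq: "(\<lambda>i. if i \<in> {k..<n} then ?u i \<oplus> of_real t \<odot> x k else ?u i) =
          (\<lambda>i\<in>{..<n}. if i < k then x i else y \<oplus> of_real t \<odot> x k)" for t
        by (auto simp: fun_eq_iff)
      \<comment> \<open>The induction hypothesis holds for every common value, in particular for y +
        t x k.\<close>
      have z: "D (\<lambda>i. if i \<in> {k..<n} then ?u i \<oplus> of_real t \<odot> x k else ?u i) = 0" for t
        unfolding eq by (rule bspec[OF Suc.IH]) (use k y xc[OF k] in auto)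
      have "((\<lambda>t. D (\<lambda>i. if i \<in> {k..<n} then ?u i \<oplus> of_real t \<odot> x k else ?u i))
          has_field_derivative (\<Sum>i\<in>{k..<n}. D (?u(i := x k)))) (at 0)"
        by (rule multilinear_has_derivative[OF _ u]) (use xc[OF k] in auto)
      then have "(\<Sum>i\<in>{k..<n}. D (?u(i := x k))) = 0"
        unfolding z by (rule DERIV_unique[OF _ DERIV_const])
      moreover have "D (?u(i := x k)) = D (?u(k := x k))" if i: "i \<in> {k..<n}" for i
      proof -
        \<comment> \<open>Slots k and i both lie in the constant block, so exchanging them merely
          moves the entry x k from slot k to slot i.\<close>
        have "Transposition.transpose k i permutes {..<n}"
          using i k by (intro permutes_swap_id) auto
        moreover have "?u(k := x k) \<in> {..<n} \<rightarrow>\<^sub>E carrier E"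
          using u k xc by (auto simp: PiE_iff extensional_def)
        moreover have "?u(k := x k) \<circ> Transposition.transpose k i = ?u(i := x k)"
          using i k by (auto simp: fun_eq_iff Transposition.transpose_def)
        ultimately show ?thesis
          using sym unfolding symmetric_map_def by metis
      qed
      then have "(\<Sum>i\<in>{k..<n}. D (?u(i := x k))) = (\<Sum>i\<in>{k..<n}. D (?u(k := x k)))"
        by (rule sum.cong[OF refl])
      ultimately have "real (n - k) * D (?u(k := x k)) = 0"
        by (simp only: sum_constant card_atLeastLessThan)
      moreover have "?u(k := x k) = (\<lambda>i\<in>{..<n}. if i < Suc k then x i else y)"
        using k by (auto simp: fun_eq_iff less_Suc_eq)
      ultimately show "D (\<lambda>i\<in>{..<n}. if i < Suc k then x i else y) = 0"
        using k by simp
    qed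
  qed
  moreover have "(\<lambda>i\<in>{..<n}. if i < n then x i else \<zero>) = x"
    using x by (auto simp: fun_eq_iff PiE_iff extensional_def)
  ultimately show ?thesis
    by (metis M.zero_closed order_refl)
qed

end

end

lemma multilinearD:
  assumes "A \<in> multilinear K n E F"
  shows "A \<in> ({..<n} \<rightarrow>\<^sub>E carrier E) \<rightarrow>\<^sub>E carrier F"
    and "x \<in> {..<n} \<rightarrow>\<^sub>E carrier E \<Longrightarrow> i < n \<Longrightarrow> u \<in> carrier E \<Longrightarrow> v \<in> carrier E \<Longrightarrow>
      A (x(i := u \<oplus>\<^bsub>E\<^esub> v)) = A (x(i := u)) \<oplus>\<^bsub>F\<^esub> A (x(i := v))"
    and "x \<in> {..<n} \<rightarrow>\<^sub>E carrier E \<Longrightarrow> i < n \<Longrightarrow> c \<in> K \<Longrightarrow> u \<in> carrier E \<Longrightarrow>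
      A (x(i := c \<odot>\<^bsub>E\<^esub> u)) = c \<odot>\<^bsub>F\<^esub> A (x(i := u))"
  using assms unfolding multilinear_def by blast+

text \<open>If A x and B x differ, a real functional f on F is positive at their difference. Then f
  A - f B is real-valued, symmetric and multilinear for real scalars and vanishes on the diagonal,
  hence everywhere.\<close>

lemma symmetric_multilinear_unique:
  assumes "rc_banach_space K E" and "rc_banach_space K F"
    and A: "A \<in> multilinear K n E F" "symmetric_map n E A"
    and B: "B \<in> multilinear K n E F" "symmetric_map n E B"
    and diag: "\<And>y. y \<in> carrier E \<Longrightarrow> A (\<lambda>i\<in>{..<n}. y) = B (\<lambda>i\<in>{..<n}. y)"
  shows "A = B"
proof -
  interpret E: rc_banach_space K E by fact
  interpret F: rc_banach_space K F by fact
  show ?thesis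
  proof (rule extensionalityI[of _ "{..<n} \<rightarrow>\<^sub>E carrier E"])
    show "A \<in> extensional ({..<n} \<rightarrow>\<^sub>E carrier E)" "B \<in> extensional ({..<n} \<rightarrow>\<^sub>E carrier E)"
      using multilinearD(1)[OF A(1)] multilinearD(1)[OF B(1)] by (auto simp: PiE_def)
    fix x assume x: "x \<in> {..<n} \<rightarrow>\<^sub>E carrier E"
    have Ac: "A y \<in> carrier F" and Bc: "B y \<in> carrier F" if "y \<in> {..<n} \<rightarrow>\<^sub>E carrier E" for y
      using that multilinearD(1)[OF A(1)] multilinearD(1)[OF B(1)] by auto
    have upd: "y(i := u) \<in> {..<n} \<rightarrow>\<^sub>E carrier E"
      if "y \<in> {..<n} \<rightarrow>\<^sub>E carrier E" "i < n" "u \<in> carrier E" for y i u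
      using that by (auto simp: PiE_iff extensional_def)
    show "A x = B x"
    proof (rule ccontr)
      assume ne: "A x \<noteq> B x"
      have "A x = (A x \<ominus>\<^bsub>F\<^esub> B x) \<oplus>\<^bsub>F\<^esub> B x"
        using Ac[OF x] Bc[OF x] by (simp add: a_minus_def F.M.a_assoc F.M.l_neg)
      then have "A x \<ominus>\<^bsub>F\<^esub> B x \<noteq> \<zero>\<^bsub>F\<^esub>"
        using ne Bc[OF x] by auto
      then obtain f where f: "F.real_functional f" and pos: "f (A x \<ominus>\<^bsub>F\<^esub> B x) > 0"
        using F.hahn_banach[of "A x \<ominus>\<^bsub>F\<^esub> B x"] Ac[OF x] Bc[OF x] by (metis F.M.minus_closed)
      have fD: "\<And>x y. x \<in> carrier F \<Longrightarrow> y \<in> carrier F \<Longrightarrow> f (x \<oplus>\<^bsub>F\<^esub> y) = f x + f y"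
        "\<And>t x. x \<in> carrier F \<Longrightarrow> f (of_real t \<odot>\<^bsub>F\<^esub> x) = t * f x"
        using f by (auto simp: F.real_functional_def)
      let ?D = "\<lambda>y. f (A y) - f (B y)"
      have "?D x = 0"
      proof (rule E.symmetric_multilinear_eq_0[of n])
        show "symmetric_map n E ?D"
          using A(2) B(2) by (simp add: symmetric_map_def)
      next
        fix y i u v
        assume *: "y \<in> {..<n} \<rightarrow>\<^sub>E carrier E" "i < n" "u \<in> carrier E" "v \<in> carrier E"
        have c: "y(i := u) \<in> {..<n} \<rightarrow>\<^sub>E carrier E" "y(i := v) \<in> {..<n} \<rightarrow>\<^sub>E carrier E"
          using * upd by blast+
        show "?D (y(i := u \<oplus>\<^bsub>E\<^esub> v)) = ?D (y(i := u)) + ?D (y(i := v))"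
          unfolding multilinearD(2)[OF A(1) *] multilinearD(2)[OF B(1) *]
            fD(1)[OF Ac[OF c(1)] Ac[OF c(2)]] fD(1)[OF Bc[OF c(1)] Bc[OF c(2)]] by simp
      next
        fix y i t u
        assume *: "y \<in> {..<n} \<rightarrow>\<^sub>E carrier E" "i < n" "u \<in> carrier E"
        have c: "y(i := u) \<in> {..<n} \<rightarrow>\<^sub>E carrier E"
          using * upd by blast
        show "?D (y(i := of_real t \<odot>\<^bsub>E\<^esub> u)) = t * ?D (y(i := u))"
          unfolding multilinearD(3)[OF A(1) *(1,2) E.scalars(1) *(3)]
            multilinearD(3)[OF B(1) *(1,2) E.scalars(1) *(3)] fD(2)[OF Ac[OF c]] fD(2)[OF Bc[OF c]]
          by (simp add: right_diff_distrib)
      qed (simp_all only: x diag diff_self)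
      moreover have "f (A x \<ominus>\<^bsub>F\<^esub> B x) = f (A x) - f (B x)"
        using fD(2)[of "B x" "-1"] Ac[OF x] Bc[OF x]
        by (simp add: a_minus_def F.minus_eq_scale fD(1))
      ultimately show False
        using pos by simp
    qed
  qed
qed

section \<open>The symmetric multilinear mapping of a power of a functional times an operator\<close>

context rc_banach_space
begin

section \<open>Limit laws for sums and scalar multiples\<close>

lemma limitin_add:
  assumes "limitin (ntop E) g l Fl" "limitin (ntop E) h m Fl"
  shows "limitin (ntop E) (\<lambda>x. g x \<oplus> h x) (l \<oplus> m) Fl"
proof -
  have l: "l \<in> carrier E" and m: "m \<in> carrier E"
    and ev: "\<forall>\<^sub>F x in Fl. g x \<in> carrier E \<and> h x \<in> carrier E"
    and lim: "((\<lambda>x. nrm E (g x \<ominus> l)) \<longlongrightarrow> 0) Fl" "((\<lambda>x. nrm E (h x \<ominus> m)) \<longlongrightarrow> 0) Fl"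
    using assms by (simp_all add: limitin_ntop eventually_conj)
  have le: "norm (nrm E ((u \<oplus> v) \<ominus> (l \<oplus> m))) \<le> nrm E (u \<ominus> l) + nrm E (v \<ominus> m)"
    if "u \<in> carrier E \<and> v \<in> carrier E" for u v
  proof -
    have "(u \<oplus> v) \<ominus> (l \<oplus> m) = (u \<ominus> l) \<oplus> (v \<ominus> m)"
      using that l m by (simp add: a_minus_def M.minus_add M.a_ac)
    then show ?thesis
      using that l m nrm_triangle[of "u \<ominus> l" "v \<ominus> m"] by (simp add: nrm_nonneg)
  qed
  have "((\<lambda>x. nrm E ((g x \<oplus> h x) \<ominus> (l \<oplus> m))) \<longlongrightarrow> 0) Fl"
  proof (rule Lim_null_comparison)
    show "\<forall>\<^sub>F x in Fl. norm (nrm E ((g x \<oplus> h x) \<ominus> (l \<oplus> m))) \<le> nrm E (g x \<ominus> l) + nrm E (h x \<ominus> m)"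
      using ev le by (rule eventually_mono)
    show "((\<lambda>x. nrm E (g x \<ominus> l) + nrm E (h x \<ominus> m)) \<longlongrightarrow> 0) Fl"
      using tendsto_add[OF lim] by simp
  qed
  moreover have "\<forall>\<^sub>F x in Fl. g x \<oplus> h x \<in> carrier E"
    using ev by (rule eventually_mono) simp
  ultimately show ?thesis
    using l m by (simp add: limitin_ntop)
qed

lemma limitin_scale:
  assumes c: "limitin (ntop (scalar_space K)) c c0 Fl" and g: "limitin (ntop E) g l Fl"
  shows "limitin (ntop E) (\<lambda>x. c x \<odot> g x) (c0 \<odot> l) Fl"
proof -
  have l: "l \<in> carrier E" and c0: "c0 \<in> K"
    and ev: "\<forall>\<^sub>F x in Fl. c x \<in> K \<and> g x \<in> carrier E"
    and lim: "((\<lambda>x. nrm E (g x \<ominus> l)) \<longlongrightarrow> 0) Fl" "(c \<longlongrightarrow> c0) Fl"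
    using assms by (simp_all add: limitin_ntop limitin_scalar_space eventually_conj)
  have le: "norm (nrm E (d \<odot> u \<ominus> c0 \<odot> l)) \<le> cmod d * nrm E (u \<ominus> l) + cmod (d - c0) * nrm E l"
    if "d \<in> K \<and> u \<in> carrier E" for d u
  proof -
    have d: "d \<in> K" and u: "u \<in> carrier E" using that by auto
    \<comment> \<open>Prepares the product rule splitting d u - c0 l = d (u - l) + (d - c0)
      l.\<close>
    have "(- d) \<odot> l \<oplus> (d - c0) \<odot> l = (- c0) \<odot> l"
      using scale_add_left[of "- d" "d - c0" l] d c0 l by simp
    then have "d \<odot> u \<ominus> c0 \<odot> l = d \<odot> (u \<ominus> l) \<oplus> (d - c0) \<odot> l"
      using d u c0 l by (simp add: a_minus_def minus_eq_scale scale_add_right scale_scale M.a_assoc)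
    then show ?thesis
      using d u c0 l nrm_triangle[of "d \<odot> (u \<ominus> l)" "(d - c0) \<odot> l"] by (simp add: nrm_nonneg nrm_smult)
  qed
  have "((\<lambda>x. nrm E (c x \<odot> g x \<ominus> c0 \<odot> l)) \<longlongrightarrow> 0) Fl"
  proof (rule Lim_null_comparison)
    show "\<forall>\<^sub>F x in Fl. norm (nrm E (c x \<odot> g x \<ominus> c0 \<odot> l)) \<le>
        cmod (c x) * nrm E (g x \<ominus> l) + cmod (c x - c0) * nrm E l"
      using ev le by (rule eventually_mono)
    have "((\<lambda>x. cmod (c x - c0)) \<longlongrightarrow> 0) Fl"
      using lim(2) by (intro tendsto_norm_zero LIM_zero)
    then show "((\<lambda>x. cmod (c x) * nrm E (g x \<ominus> l) + cmod (c x - c0) * nrm E l) \<longlongrightarrow> 0) Fl"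
      using tendsto_add[OF tendsto_mult[OF tendsto_norm[OF lim(2)] lim(1)] tendsto_mult_right[of _ 0 _ "nrm E l"]]
      by simp
  qed
  moreover have "\<forall>\<^sub>F x in Fl. c x \<odot> g x \<in> carrier E"
    using ev by (rule eventually_mono) simp
  ultimately show ?thesis
    using l c0 by (simp add: limitin_ntop)
qed

lemma limitin_finsum:
  assumes "finite I" "\<And>i. i \<in> I \<Longrightarrow> limitin (ntop E) (g i) (l i) Fl"
  shows "limitin (ntop E) (\<lambda>x. \<Oplus>i\<in>I. g i x) (\<Oplus>i\<in>I. l i) Fl"
  using assms
proof (induction I rule: finite_induct)
  case empty
  then show ?case
    by (simp add: limitin_ntop a_minus_def)
next
  case (insert j I)
  have l: "l i \<in> carrier E" "\<forall>\<^sub>F x in Fl. g i x \<in> carrier E" if "i \<in> insert j I" for i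
    using insert.prems[OF that] by (simp_all add: limitin_ntop)
  \<comment> \<open>A finite sum can be split only where all summands lie in the carrier. This holds
    just eventually, so the limit is transferred along an eventual equality.\<close>
  have "\<forall>\<^sub>F x in Fl. \<forall>i\<in>insert j I. g i x \<in> carrier E"
    using insert(1) l(2) by (intro eventually_ball_finite) auto
  then have ev: "\<forall>\<^sub>F x in Fl. g j x \<oplus> (\<Oplus>i\<in>I. g i x) = (\<Oplus>i\<in>insert j I. g i x)"
    by (rule eventually_mono) (use insert(1,2) in \<open>simp add: M.finsum_insert Pi_def\<close>)
  have "limitin (ntop E) (\<lambda>x. g j x \<oplus> (\<Oplus>i\<in>I. g i x)) (l j \<oplus> (\<Oplus>i\<in>I. l i)) Fl"
    using insert.prems by (intro limitin_add insert.IH) auto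
  moreover have "l j \<oplus> (\<Oplus>i\<in>I. l i) = (\<Oplus>i\<in>insert j I. l i)"
    using insert(1,2) l(1) by (simp add: M.finsum_insert Pi_def)
  ultimately show ?case
    using limitin_transform_eventually[OF ev] by simp
qed

lemma finsum_const_scale:
  assumes "finite I" "v \<in> carrier E"
  shows "(\<Oplus>i\<in>I. v) = of_nat (card I) \<odot> v"
  using assms(1)
proof (induction I rule: finite_induct)
  case (insert j I)
  then show ?case
    using assms(2) scale_add_left[of 1 "of_nat (card I)" v] by (simp add: M.finsum_insert)
qed (use assms(2) in simp)

end

lemma lin_opsD:
  assumes "T \<in> lin_ops K E F"
  shows "T \<in> extensional (carrier E)"
    and "x \<in> carrier E \<Longrightarrow> T x \<in> carrier F"
    and "x \<in> carrier E \<Longrightarrow> y \<in> carrier E \<Longrightarrow> T (x \<oplus>\<^bsub>E\<^esub> y) = T x \<oplus>\<^bsub>F\<^esub> T y"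
    and "c \<in> K \<Longrightarrow> x \<in> carrier E \<Longrightarrow> T (c \<odot>\<^bsub>E\<^esub> x) = c \<odot>\<^bsub>F\<^esub> T x"
    and "continuous_map (ntop E) (ntop F) T"
  using assms by (auto simp: lin_ops_def PiE_def)

section \<open>Explicit symmetrisation of a power of a functional times an operator\<close>

locale functional_times_operator =
  E: rc_banach_space K E + F: rc_banach_space K F
  for K and E :: "'a normed_module" and F :: "'b normed_module" +
  fixes \<phi> :: "'a \<Rightarrow> complex" and T :: "'a \<Rightarrow> 'b" and n :: nat
  assumes \<phi>: "\<phi> \<in> lin_ops K E (scalar_space K)" and T: "T \<in> lin_ops K E F" and n: "n \<ge> 1"
begin

lemmas \<phi>_simps = lin_opsD[OF \<phi>, unfolded scalar_space_simps]
lemmas T_simps = lin_opsD[OF T]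

abbreviation tuples :: "(nat \<Rightarrow> 'a) set" where
  "tuples \<equiv> {..<n} \<rightarrow>\<^sub>E carrier E"

definition term_at :: "nat \<Rightarrow> (nat \<Rightarrow> 'a) \<Rightarrow> 'b" where
  "term_at i x = (\<Prod>j\<in>{..<n} - {i}. \<phi> (x j)) \<odot>\<^bsub>F\<^esub> T (x i)"

text \<open>Averaging over the n positions of T replaces the sum over all n! permutations, because
  the product of the \<phi> values ignores the order of the remaining arguments.\<close>

definition sym_map :: "(nat \<Rightarrow> 'a) \<Rightarrow> 'b" where
  "sym_map = (\<lambda>x\<in>tuples. inverse (of_nat n) \<odot>\<^bsub>F\<^esub> (\<Oplus>\<^bsub>F\<^esub>i\<in>{..<n}. term_at i x))"

lemma tuple_closed: "x \<in> tuples \<Longrightarrow> i < n \<Longrightarrow> x i \<in> carrier E"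
  by auto

lemma upd_tuple: "x \<in> tuples \<Longrightarrow> i < n \<Longrightarrow> u \<in> carrier E \<Longrightarrow> x(i := u) \<in> tuples"
  by (auto simp: PiE_iff extensional_def)

lemma coefficient_closed: "x \<in> tuples \<Longrightarrow> J \<subseteq> {..<n} \<Longrightarrow> (\<Prod>j\<in>J. \<phi> (x j)) \<in> K"
  by (rule E.scalars_prod) (use \<phi>_simps(2) tuple_closed in blast)

lemma term_at_closed: "x \<in> tuples \<Longrightarrow> i < n \<Longrightarrow> term_at i x \<in> carrier F"
  unfolding term_at_def
  by (intro F.scale_closed coefficient_closed T_simps(2)) (auto simp: tuple_closed)

lemma sum_terms_closed: "x \<in> tuples \<Longrightarrow> (\<Oplus>\<^bsub>F\<^esub>i\<in>{..<n}. term_at i x) \<in> carrier F"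
  by (rule F.M.finsum_closed) (simp add: term_at_closed)

lemma term_at_upd_same:
  "term_at k (x(k := w)) = (\<Prod>j\<in>{..<n} - {k}. \<phi> (x j)) \<odot>\<^bsub>F\<^esub> T w"
proof -
  have "(\<Prod>j\<in>{..<n} - {k}. \<phi> ((x(k := w)) j)) = (\<Prod>j\<in>{..<n} - {k}. \<phi> (x j))"
    by (rule prod.cong) auto
  then show ?thesis by (simp add: term_at_def)
qed

text \<open>Isolates the single factor through which slot k acts when T sits elsewhere, so that
  linearity in slot k becomes linearity of \<phi>.\<close>

lemma term_at_upd_other:
  assumes "i \<noteq> k" "k < n"
  shows "term_at i (x(k := w)) = (\<phi> w * (\<Prod>j\<in>{..<n} - {i} - {k}. \<phi> (x j))) \<odot>\<^bsub>F\<^esub> T (x i)"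
proof -
  have "(\<Prod>j\<in>{..<n} - {i}. \<phi> ((x(k := w)) j)) =
      \<phi> ((x(k := w)) k) * (\<Prod>j\<in>{..<n} - {i} - {k}. \<phi> ((x(k := w)) j))"
    using assms by (intro prod.remove) auto
  also have "(\<Prod>j\<in>{..<n} - {i} - {k}. \<phi> ((x(k := w)) j)) = (\<Prod>j\<in>{..<n} - {i} - {k}. \<phi> (x j))"
    by (rule prod.cong) auto
  finally show ?thesis
    using assms by (simp add: term_at_def)
qed

lemma term_at_add:
  assumes x: "x \<in> tuples" and k: "k < n" and i: "i < n" and uv: "u \<in> carrier E" "v \<in> carrier E"
  shows "term_at i (x(k := u \<oplus>\<^bsub>E\<^esub> v)) = term_at i (x(k := u)) \<oplus>\<^bsub>F\<^esub> term_at i (x(k := v))"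
proof (cases "i = k")
  case True
  have "(\<Prod>j\<in>{..<n} - {k}. \<phi> (x j)) \<in> K"
    using x by (intro coefficient_closed) auto
  then show ?thesis
    unfolding True term_at_upd_same using uv by (simp add: T_simps F.scale_add_right)
next
  case False
  have "(\<Prod>j\<in>{..<n} - {i} - {k}. \<phi> (x j)) \<in> K"
    using x by (intro coefficient_closed) auto
  then show ?thesis
    unfolding term_at_upd_other[OF False k] using uv tuple_closed[OF x i]
    by (simp add: T_simps \<phi>_simps distrib_right F.scale_add_left)
qed

lemma term_at_scale:
  assumes x: "x \<in> tuples" and k: "k < n" and i: "i < n" and u: "u \<in> carrier E" and c: "c \<in> K"
  shows "term_at i (x(k := c \<odot>\<^bsub>E\<^esub> u)) = c \<odot>\<^bsub>F\<^esub> term_at i (x(k := u))"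
proof (cases "i = k")
  case True
  have "(\<Prod>j\<in>{..<n} - {k}. \<phi> (x j)) \<in> K"
    using x by (intro coefficient_closed) auto
  then show ?thesis
    unfolding True term_at_upd_same using u c
    by (simp add: T_simps F.scale_scale mult.commute)
next
  case False
  have "(\<Prod>j\<in>{..<n} - {i} - {k}. \<phi> (x j)) \<in> K"
    using x by (intro coefficient_closed) auto
  then show ?thesis
    unfolding term_at_upd_other[OF False k] using u c tuple_closed[OF x i]
    by (simp add: T_simps \<phi>_simps F.scale_scale mult.assoc)
qed

lemma inverse_n: "inverse (of_nat n) \<in> K"
  by (intro E.scalars_closed E.scalars)

lemma sym_map_apply:
  "x \<in> tuples \<Longrightarrow> sym_map x = inverse (of_nat n) \<odot>\<^bsub>F\<^esub> (\<Oplus>\<^bsub>F\<^esub>i\<in>{..<n}. term_at i x)"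
  unfolding sym_map_def by (rule restrict_apply')

lemma sym_map_multilinear: "sym_map \<in> multilinear K n E F"
  unfolding multilinear_def mem_Collect_eq
proof (intro conjI ballI allI impI)
  show "sym_map \<in> tuples \<rightarrow>\<^sub>E carrier F"
    unfolding sym_map_def restrict_PiE_iff
    by (intro ballI F.scale_closed inverse_n sum_terms_closed)
next
  fix x k u v assume x: "x \<in> tuples" and k: "k < n" and uv: "u \<in> carrier E" "v \<in> carrier E"
  note c = upd_tuple[OF x k]
  have "(\<Oplus>\<^bsub>F\<^esub>i\<in>{..<n}. term_at i (x(k := u \<oplus>\<^bsub>E\<^esub> v))) =
      (\<Oplus>\<^bsub>F\<^esub>i\<in>{..<n}. term_at i (x(k := u)) \<oplus>\<^bsub>F\<^esub> term_at i (x(k := v)))"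
    using c uv x k by (intro F.M.finsum_cong') (auto simp: term_at_add term_at_closed)
  also have "\<dots> = (\<Oplus>\<^bsub>F\<^esub>i\<in>{..<n}. term_at i (x(k := u))) \<oplus>\<^bsub>F\<^esub> (\<Oplus>\<^bsub>F\<^esub>i\<in>{..<n}. term_at i (x(k := v)))"
    using c uv by (intro F.M.finsum_addf) (auto simp: term_at_closed)
  finally show "sym_map (x(k := u \<oplus>\<^bsub>E\<^esub> v)) = sym_map (x(k := u)) \<oplus>\<^bsub>F\<^esub> sym_map (x(k := v))"
    using F.scale_add_right[OF inverse_n sum_terms_closed[OF c[OF uv(1)]] sum_terms_closed[OF c[OF uv(2)]]]
      sym_map_apply[OF c] uv by simp
next
  fix x k c u assume x: "x \<in> tuples" and k: "k < n" and c: "c \<in> K" and u: "u \<in> carrier E"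
  note t = upd_tuple[OF x k]
  have "(\<Oplus>\<^bsub>F\<^esub>i\<in>{..<n}. term_at i (x(k := c \<odot>\<^bsub>E\<^esub> u))) = (\<Oplus>\<^bsub>F\<^esub>i\<in>{..<n}. c \<odot>\<^bsub>F\<^esub> term_at i (x(k := u)))"
    using t u c x k by (intro F.M.finsum_cong') (auto simp: term_at_scale term_at_closed)
  also have "\<dots> = c \<odot>\<^bsub>F\<^esub> (\<Oplus>\<^bsub>F\<^esub>i\<in>{..<n}. term_at i (x(k := u)))"
    using t u c by (intro F.finsum_smult_ldistr[symmetric]) (auto simp: term_at_closed scalar_field_simps)
  finally show "sym_map (x(k := c \<odot>\<^bsub>E\<^esub> u)) = c \<odot>\<^bsub>F\<^esub> sym_map (x(k := u))"
    using sym_map_apply[OF t[OF u]] sym_map_apply[OF t[of "c \<odot>\<^bsub>E\<^esub> u"]] u c inverse_n sum_terms_closed[OF t[OF u]]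
    by (simp add: F.scale_scale mult.commute)
qed

text \<open>Permuting the arguments permutes the summands: position i of the permuted tuple is
  position p i of the original one.\<close>

lemma sym_map_symmetric: "symmetric_map n E sym_map"
  unfolding symmetric_map_def
proof (intro allI impI ballI)
  fix p x assume p: "p permutes {..<n}" and x: "x \<in> tuples"
  have xp: "x \<circ> p \<in> tuples"
    using x permutes_in_image[OF p] by (auto simp: PiE_iff extensional_def)
  have t: "term_at i (x \<circ> p) = term_at (p i) x" if "i < n" for i
  proof -
    have "bij_betw p ({..<n} - {i}) ({..<n} - {p i})"
      using permutes_image[OF p]
      by (intro bij_betw_imageI permutes_inj_on[OF p]) (simp add: image_set_diff[OF permutes_inj[OF p]])
    from prod.reindex_bij_betw[OF this, of "\<lambda>j. \<phi> (x j)"] show ?thesis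
      by (simp add: term_at_def)
  qed
  have "(\<Oplus>\<^bsub>F\<^esub>i\<in>{..<n}. term_at i (x \<circ> p)) = (\<Oplus>\<^bsub>F\<^esub>i\<in>{..<n}. term_at (p i) x)"
    using x permutes_in_image[OF p] by (intro F.M.finsum_cong') (auto simp: t term_at_closed)
  also have "\<dots> = (\<Oplus>\<^bsub>F\<^esub>i\<in>p ` {..<n}. term_at i x)"
    using x permutes_in_image[OF p] permutes_inj_on[OF p]
    by (intro F.M.finsum_reindex[symmetric]) (auto simp: term_at_closed)
  finally show "sym_map (x \<circ> p) = sym_map x"
    using sym_map_apply[OF xp] sym_map_apply[OF x] permutes_image[OF p] by simp
qed

lemma sym_map_continuous:
  "continuous_map (product_topology (\<lambda>_. ntop E) {..<n}) (ntop F) sym_map"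
proof -
  let ?X = "product_topology (\<lambda>_. ntop E) {..<n}"
  have top: "topspace ?X = tuples"
    by simp
  \<comment> \<open>Limits are computed for the formula without the restriction in
    \<open>sym_map\<close>; both agree on the topological space, which suffices for
    continuity.\<close>
  let ?A = "\<lambda>x. inverse (of_nat n) \<odot>\<^bsub>F\<^esub> (\<Oplus>\<^bsub>F\<^esub>i\<in>{..<n}. term_at i x)"
  have "continuous_map ?X (ntop F) ?A"
    unfolding continuous_map_atin
  proof
    fix x assume "x \<in> topspace ?X"
    then have x: "x \<in> tuples" unfolding top .
    let ?F = "atin ?X x"
    have proj: "limitin (ntop E) (\<lambda>y. y j) (x j) ?F" if "j < n" for j
      using continuous_map_product_projection[of j "{..<n}" "\<lambda>_. ntop E"] that x
      by (simp add: continuous_map_atin)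
    have lim\<phi>: "limitin (ntop (scalar_space K)) (\<lambda>y. \<phi> (y j)) (\<phi> (x j)) ?F" if "j < n" for j
      using continuous_map_limit[OF \<phi>_simps(5) proj[OF that]] by (simp add: o_def)
    have limT: "limitin (ntop F) (\<lambda>y. T (y j)) (T (x j)) ?F" if "j < n" for j
      using continuous_map_limit[OF T_simps(5) proj[OF that]] by (simp add: o_def)
    have "limitin (ntop (scalar_space K)) (\<lambda>y. \<Prod>j\<in>J. \<phi> (y j)) (\<Prod>j\<in>J. \<phi> (x j)) ?F"
      if J: "J \<subseteq> {..<n}" for J
      unfolding E.limitin_scalar_space
    proof (intro conjI)
      have l: "\<phi> (x j) \<in> K" "\<forall>\<^sub>F y in ?F. \<phi> (y j) \<in> K" "((\<lambda>y. \<phi> (y j)) \<longlongrightarrow> \<phi> (x j)) ?F" if "j \<in> J" for j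
        using lim\<phi>[of j] J that unfolding E.limitin_scalar_space by auto
      show "(\<Prod>j\<in>J. \<phi> (x j)) \<in> K"
        using l(1) by (rule E.scalars_prod)
      have "\<forall>\<^sub>F y in ?F. \<forall>j\<in>J. \<phi> (y j) \<in> K"
        using l(2) finite_subset[OF J] by (intro eventually_ball_finite) auto
      then show "\<forall>\<^sub>F y in ?F. (\<Prod>j\<in>J. \<phi> (y j)) \<in> K"
        by (rule eventually_mono) (rule E.scalars_prod, blast)
      show "((\<lambda>y. \<Prod>j\<in>J. \<phi> (y j)) \<longlongrightarrow> (\<Prod>j\<in>J. \<phi> (x j))) ?F"
        using l(3) by (rule tendsto_prod)
    qed
    then have "limitin (ntop F) (term_at i) (term_at i x) ?F" if "i < n" for i
      unfolding term_at_def using limT[OF that] by (intro F.limitin_scale) auto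
    moreover have "limitin (ntop (scalar_space K)) (\<lambda>_. inverse (of_nat n)) (inverse (of_nat n)) ?F"
      unfolding F.limitin_scalar_space using inverse_n by simp
    ultimately show "limitin (ntop F) ?A (?A x) ?F"
      by (intro F.limitin_scale F.limitin_finsum) auto
  qed
  then show ?thesis
    by (rule continuous_map_eq) (simp only: top sym_map_apply)
qed

lemma sym_map_diagonal:
  assumes y: "y \<in> carrier E"
  shows "sym_map (\<lambda>i\<in>{..<n}. y) = \<phi> y ^ (n - 1) \<odot>\<^bsub>F\<^esub> T y"
proof -
  have t: "(\<lambda>i\<in>{..<n}. y) \<in> tuples"
    using y by auto
  let ?v = "\<phi> y ^ (n - 1) \<odot>\<^bsub>F\<^esub> T y"
  have v: "?v \<in> carrier F"
    using y by (simp add: \<phi>_simps T_simps)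
  have "term_at i (\<lambda>i\<in>{..<n}. y) = ?v" if "i < n" for i
  proof -
    have "(\<Prod>j\<in>{..<n} - {i}. \<phi> ((\<lambda>i\<in>{..<n}. y) j)) = (\<Prod>j\<in>{..<n} - {i}. \<phi> y)"
      by (rule prod.cong) auto
    then show ?thesis
      using that by (simp add: term_at_def)
  qed
  then have "(\<Oplus>\<^bsub>F\<^esub>i\<in>{..<n}. term_at i (\<lambda>i\<in>{..<n}. y)) = (\<Oplus>\<^bsub>F\<^esub>i\<in>{..<n}. ?v)"
    using v by (intro F.M.finsum_cong') auto
  also have "\<dots> = of_nat n \<odot>\<^bsub>F\<^esub> ?v"
    using F.finsum_const_scale[of "{..<n}" ?v] v by simp
  finally show ?thesis
    unfolding sym_map_apply[OF t] using v n inverse_n by (simp add: F.scale_scale)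
qed

text \<open>\<open>sym_map\<close> meets every clause of the definite description, and
  \<open>symmetric_multilinear_unique\<close> excludes any other map.\<close>

lemma assoc_multilinear_eq_sym_map:
  "assoc_multilinear K n E F (\<lambda>x\<in>carrier E. \<phi> x ^ (n - 1) \<odot>\<^bsub>F\<^esub> T x) = sym_map"
  unfolding assoc_multilinear_def
proof (rule the_equality)
  show "sym_map \<in> cont_multilinear K n E F \<and> symmetric_map n E sym_map \<and>
      (\<forall>x\<in>carrier E. sym_map (\<lambda>i\<in>{..<n}. x) = (\<lambda>x\<in>carrier E. \<phi> x ^ (n - 1) \<odot>\<^bsub>F\<^esub> T x) x)"
    unfolding cont_multilinear_def
    using sym_map_multilinear sym_map_continuous sym_map_symmetric sym_map_diagonal by auto
next
  fix A assume A: "A \<in> cont_multilinear K n E F \<and> symmetric_map n E A \<and>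
      (\<forall>x\<in>carrier E. A (\<lambda>i\<in>{..<n}. x) = (\<lambda>x\<in>carrier E. \<phi> x ^ (n - 1) \<odot>\<^bsub>F\<^esub> T x) x)"
  show "A = sym_map"
  proof (rule symmetric_multilinear_unique[OF E.rc_banach_space_axioms F.rc_banach_space_axioms])
    show "A \<in> multilinear K n E F" "symmetric_map n E A"
      using A by (auto simp: cont_multilinear_def)
    show "sym_map \<in> multilinear K n E F" "symmetric_map n E sym_map"
      by (rule sym_map_multilinear sym_map_symmetric)+
    show "A (\<lambda>i\<in>{..<n}. y) = sym_map (\<lambda>i\<in>{..<n}. y)" if "y \<in> carrier E" for y
      using A that sym_map_diagonal[OF that] by simp
  qed
qed

text \<open>With \<phi> a = 1, the slot 0 summand is T x, while each of the other n - 1 summands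
  applies T to a and meets x in exactly one factor \<phi> x. The factor \<open>of_nat n\<close>
  clears the average.\<close>

lemma sym_map_partial:
  assumes x: "x \<in> carrier E" and a: "a \<in> carrier E" "\<phi> a = 1"
  shows "of_nat n \<odot>\<^bsub>F\<^esub> sym_map (\<lambda>i\<in>{..<n}. if i = 0 then x else a) =
    T x \<oplus>\<^bsub>F\<^esub> of_nat (n - 1) \<odot>\<^bsub>F\<^esub> (\<phi> x \<odot>\<^bsub>F\<^esub> T a)"
proof -
  let ?x = "\<lambda>i\<in>{..<n}. if i = 0 then x else a"
  let ?v = "\<phi> x \<odot>\<^bsub>F\<^esub> T a"
  have t: "?x \<in> tuples"
    using x a by auto
  have v: "?v \<in> carrier F"
    using x a by (simp add: \<phi>_simps T_simps)
  have "(\<Prod>j\<in>{..<n} - {0}. \<phi> (?x j)) = 1"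
    by (rule prod.neutral) (auto simp: a)
  then have t0: "term_at 0 ?x = T x"
    using n x by (simp add: term_at_def T_simps)
  have ti: "term_at i ?x = ?v" if i: "i \<in> {1..<n}" for i
  proof -
    have "(\<Prod>j\<in>{..<n} - {i}. \<phi> (?x j)) = \<phi> (?x 0) * (\<Prod>j\<in>{..<n} - {i} - {0}. \<phi> (?x j))"
      using i n by (intro prod.remove) auto
    also have "(\<Prod>j\<in>{..<n} - {i} - {0}. \<phi> (?x j)) = 1"
      by (rule prod.neutral) (auto simp: a)
    finally show ?thesis
      using i n by (simp add: term_at_def)
  qed
  have "{..<n} = insert 0 {1..<n}"
    using n by auto
  then have "(\<Oplus>\<^bsub>F\<^esub>i\<in>{..<n}. term_at i ?x) = term_at 0 ?x \<oplus>\<^bsub>F\<^esub> (\<Oplus>\<^bsub>F\<^esub>i\<in>{1..<n}. term_at i ?x)"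
    using t n term_at_closed by (simp only:) (intro F.M.finsum_insert, auto)
  also have "(\<Oplus>\<^bsub>F\<^esub>i\<in>{1..<n}. term_at i ?x) = (\<Oplus>\<^bsub>F\<^esub>i\<in>{1..<n}. ?v)"
    using v ti by (intro F.M.finsum_cong') auto
  also have "\<dots> = of_nat (n - 1) \<odot>\<^bsub>F\<^esub> ?v"
    using F.finsum_const_scale[of "{1..<n}" ?v] v by simp
  finally have S: "(\<Oplus>\<^bsub>F\<^esub>i\<in>{..<n}. term_at i ?x) = T x \<oplus>\<^bsub>F\<^esub> of_nat (n - 1) \<odot>\<^bsub>F\<^esub> ?v"
    unfolding t0 .
  have "of_nat n \<odot>\<^bsub>F\<^esub> sym_map ?x = (of_nat n * inverse (of_nat n)) \<odot>\<^bsub>F\<^esub> (\<Oplus>\<^bsub>F\<^esub>i\<in>{..<n}. term_at i ?x)"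
    unfolding sym_map_apply[OF t] using sum_terms_closed[OF t] inverse_n by (intro F.scale_scale) auto
  then show ?thesis
    using n sum_terms_closed[OF t] S by simp
qed

end

section \<open>Components of ideals and the conclusion\<close>

lemma component_closed:
  assumes "poly_ideal K I" "1 \<le> n" "banach_space K E" "banach_space K F"
  shows "P \<in> component K I n E F \<Longrightarrow> Q \<in> component K I n E F \<Longrightarrow>
      (\<lambda>x\<in>carrier E. P x \<oplus>\<^bsub>F\<^esub> Q x) \<in> component K I n E F"
    and "c \<in> K \<Longrightarrow> P \<in> component K I n E F \<Longrightarrow>
      (\<lambda>x\<in>carrier E. c \<odot>\<^bsub>F\<^esub> P x) \<in> component K I n E F"
    and "finite_type_polys K n E F \<subseteq> component K I n E F"
proof -
  have *: "submodule (component K I n E F) (scalar_field K) (poly_space K n E F)"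
    and "finite_type_polys K n E F \<subseteq> component K I n E F"
    using assms by (auto simp: poly_ideal_def)
  then show "finite_type_polys K n E F \<subseteq> component K I n E F"
    by simp
  show "P \<in> component K I n E F \<Longrightarrow> Q \<in> component K I n E F \<Longrightarrow>
      (\<lambda>x\<in>carrier E. P x \<oplus>\<^bsub>F\<^esub> Q x) \<in> component K I n E F"
    using subgroup.m_closed[OF submodule.axioms(1)[OF *]] by (simp add: poly_space_def)
  show "c \<in> K \<Longrightarrow> P \<in> component K I n E F \<Longrightarrow>
      (\<lambda>x\<in>carrier E. c \<odot>\<^bsub>F\<^esub> P x) \<in> component K I n E F"
    using submodule.smult_closed[OF *, of c P] by (simp add: poly_space_def scalar_field_simps)
qed

text \<open>Rank one operators are finite type polynomials of degree 1 with a single summand. The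
  free coefficient \<open>c\<close> later carries the negative sign of the correction.\<close>

lemma functional_smult_in_component:
  assumes "poly_ideal K I" "banach_space K E" "banach_space K F"
    and "\<phi> \<in> lin_ops K E (scalar_space K)" "c \<in> K" "y \<in> carrier F"
  shows "(\<lambda>x\<in>carrier E. c \<odot>\<^bsub>F\<^esub> (\<phi> x \<odot>\<^bsub>F\<^esub> y)) \<in> component K I 1 E F"
proof -
  interpret F: banach_space K F by fact
  have "(\<lambda>x\<in>carrier E. \<Oplus>\<^bsub>F\<^esub>j\<in>{..<1::nat}. c \<odot>\<^bsub>F\<^esub> (\<phi> x ^ 1 \<odot>\<^bsub>F\<^esub> y)) \<in> finite_type_polys K 1 E F"
    unfolding finite_type_polys_def mem_Collect_eq using assms
    by (intro exI[of _ "1::nat"] exI[of _ "\<lambda>_. c"] exI[of _ "\<lambda>_. \<phi>"] exI[of _ "\<lambda>_. y"]) simp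
  moreover have "(\<Oplus>\<^bsub>F\<^esub>j\<in>{..<1::nat}. c \<odot>\<^bsub>F\<^esub> (\<phi> x ^ 1 \<odot>\<^bsub>F\<^esub> y)) = c \<odot>\<^bsub>F\<^esub> (\<phi> x \<odot>\<^bsub>F\<^esub> y)"
    if x: "x \<in> carrier E" for x
  proof -
    have "\<phi> x \<in> K"
      using lin_opsD(2)[OF assms(4) x] by (simp add: scalar_space_simps)
    then have "c \<odot>\<^bsub>F\<^esub> (\<phi> x \<odot>\<^bsub>F\<^esub> y) \<in> carrier F"
      using F.smult_closed assms(5,6) by (simp add: scalar_field_simps)
    then show ?thesis
      using F.M.finsum_insert[of "{}" "0::nat" "\<lambda>_. c \<odot>\<^bsub>F\<^esub> (\<phi> x \<odot>\<^bsub>F\<^esub> y)"] by (simp add: lessThan_Suc)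
  qed
  ultimately show ?thesis
    using component_closed(3)[OF assms(1) order_refl assms(2,3)]
    by (metis (no_types, lifting) restrict_ext subsetD)
qed

theorem proposition4:
  fixes K :: "complex set"
    and I1 I2 :: "'u poly_class"
    and E F :: "'u normed_module"
    and n :: nat
  assumes "K = \<real> \<or> K = UNIV"
    and "poly_ideal K I1" and "poly_ideal K I2"
    and "banach_space K E" and "banach_space K F" and "n \<ge> 1"
    and "component K I1 n E F \<subseteq> component K I2 n E F"
    and "\<And>P a. P \<in> component K I2 n E F \<Longrightarrow> a \<in> carrier E \<Longrightarrow>
           (\<lambda>x\<in>carrier E. assoc_multilinear K n E F P (\<lambda>i\<in>{..<n}. if i = 0 then x else a))
             \<in> component K I2 1 E F"
    and "\<And>m P \<phi>. 1 \<le> m \<Longrightarrow> m < n \<Longrightarrow> P \<in> component K I1 m E F \<Longrightarrow>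
           \<phi> \<in> lin_ops K E (scalar_space K) \<Longrightarrow>
           poly_times_functional E F P \<phi> \<in> component K I1 (m + 1) E F"
  shows "component K I1 1 E F \<subseteq> component K I2 1 E F"
proof
  fix T assume T1: "T \<in> component K I1 1 E F"
  interpret E: rc_banach_space K E
    using assms(1,4) by (simp add: rc_banach_space_def rc_banach_space_axioms_def)
  interpret F: rc_banach_space K F
    using assms(1,5) by (simp add: rc_banach_space_def rc_banach_space_axioms_def)
  have T: "T \<in> lin_ops K E F"
    using T1 cont_polys_1[OF assms(4), of F] by (simp add: component_def)
  note T_simps = lin_opsD[OF T]
  show "T \<in> component K I2 1 E F"
  proof (cases "carrier E = {\<zero>\<^bsub>E\<^esub>}")
    case True
    have "T \<zero>\<^bsub>E\<^esub> = \<zero>\<^bsub>F\<^esub>"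
      using T_simps(4)[of 0 "\<zero>\<^bsub>E\<^esub>"] T_simps(2)[of "\<zero>\<^bsub>E\<^esub>"] by simp
    then have "T = (\<lambda>x\<in>carrier E. 0 \<odot>\<^bsub>F\<^esub> T x)"
      using True T_simps(1,2) by (auto simp: fun_eq_iff extensional_def)
    \<comment> \<open>The empty sum, that is \<open>m = 0\<close> in
      \<open>finite_type_polys\<close>, exhibits the zero operator as of finite type.\<close>
    moreover have "(\<lambda>x\<in>carrier E. 0 \<odot>\<^bsub>F\<^esub> T x) = (\<lambda>x\<in>carrier E. \<Oplus>\<^bsub>F\<^esub>j\<in>{..<0::nat}. \<zero>\<^bsub>F\<^esub>)"
      using T_simps(2) by (auto simp: fun_eq_iff)
    moreover have "(\<lambda>x\<in>carrier E. \<Oplus>\<^bsub>F\<^esub>j\<in>{..<0::nat}. \<zero>\<^bsub>F\<^esub>) \<in> finite_type_polys K 1 E F"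
      unfolding finite_type_polys_def mem_Collect_eq
      by (rule exI[of _ "0::nat"]) simp
    ultimately show ?thesis
      using component_closed(3)[OF assms(3) order_refl assms(4,5)] by auto
  next
    case False
    then obtain b where "b \<in> carrier E" "b \<noteq> \<zero>\<^bsub>E\<^esub>"
      using E.M.zero_closed by blast
    then obtain \<phi> where \<phi>: "\<phi> \<in> lin_ops K E (scalar_space K)" and b: "b \<in> carrier E" "\<phi> b = 1"
      using E.exists_scalar_functional by metis
    note \<phi>_simps = lin_opsD[OF \<phi>, unfolded scalar_space_simps]
    interpret functional_times_operator K E F \<phi> T n
      by unfold_locales (rule \<phi> T assms(6))+
    \<comment> \<open>The exponent k belongs to degree k + 1. Each step from k to k + 1 applies
      hypothesis (ii) at degree k + 1 < n, and k = n - 1 reaches degree n.\<close>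
    have "(\<lambda>x\<in>carrier E. \<phi> x ^ k \<odot>\<^bsub>F\<^esub> T x) \<in> component K I1 (k + 1) E F" if "k < n" for k
      using that
    proof (induction k)
      case 0
      have "(\<lambda>x\<in>carrier E. \<phi> x ^ 0 \<odot>\<^bsub>F\<^esub> T x) = T"
        using T_simps(1,2) by (auto simp: fun_eq_iff extensional_def)
      then show ?case
        using T1 by simp
    next
      case (Suc k)
      have eq: "poly_times_functional E F (\<lambda>x\<in>carrier E. \<phi> x ^ k \<odot>\<^bsub>F\<^esub> T x) \<phi> =
          (\<lambda>x\<in>carrier E. \<phi> x ^ Suc k \<odot>\<^bsub>F\<^esub> T x)"
        using T_simps(2) \<phi>_simps(2)
        by (auto simp: poly_times_functional_def fun_eq_iff F.scale_scale)
      have "poly_times_functional E F (\<lambda>x\<in>carrier E. \<phi> x ^ k \<odot>\<^bsub>F\<^esub> T x) \<phi> \<in>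
          component K I1 (k + 1 + 1) E F"
        by (rule assms(9)[OF _ _ Suc.IH[OF Suc_lessD[OF Suc.prems]] \<phi>]) (use Suc.prems in auto)
      then show ?case
        unfolding eq by (simp only: Suc_eq_plus1)
    qed
    from this[of "n - 1"] have "(\<lambda>x\<in>carrier E. \<phi> x ^ (n - 1) \<odot>\<^bsub>F\<^esub> T x) \<in> component K I2 n E F"
      using assms(6,7) by auto
    from assms(8)[OF this b(1)]
    have "(\<lambda>x\<in>carrier E. sym_map (\<lambda>i\<in>{..<n}. if i = 0 then x else b)) \<in> component K I2 1 E F"
      unfolding assoc_multilinear_eq_sym_map .
    \<comment> \<open>Multiplying by n inside the subspace removes the average, so T itself appears
      with coefficient 1.\<close>
    from component_closed(2)[OF assms(3) order_refl assms(4,5) _ this, of "of_nat n"]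
    have L: "(\<lambda>x\<in>carrier E. T x \<oplus>\<^bsub>F\<^esub> of_nat (n - 1) \<odot>\<^bsub>F\<^esub> (\<phi> x \<odot>\<^bsub>F\<^esub> T b)) \<in> component K I2 1 E F"
      using sym_map_partial[OF _ b] by (simp cong: restrict_cong)
    \<comment> \<open>The negative of the rank one part of \<open>L\<close>, present in the second
      ideal because it is of finite type; adding it to \<open>L\<close> leaves T.\<close>
    have R: "(\<lambda>x\<in>carrier E. (- of_nat (n - 1)) \<odot>\<^bsub>F\<^esub> (\<phi> x \<odot>\<^bsub>F\<^esub> T b)) \<in> component K I2 1 E F"
      using b T_simps(2) by (intro functional_smult_in_component assms \<phi>) auto
    have "T x \<oplus>\<^bsub>F\<^esub> of_nat (n - 1) \<odot>\<^bsub>F\<^esub> (\<phi> x \<odot>\<^bsub>F\<^esub> T b) \<oplus>\<^bsub>F\<^esub>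
        (- of_nat (n - 1)) \<odot>\<^bsub>F\<^esub> (\<phi> x \<odot>\<^bsub>F\<^esub> T b) = T x" if x: "x \<in> carrier E" for x
    proof -
      have v: "\<phi> x \<odot>\<^bsub>F\<^esub> T b \<in> carrier F"
        using x b T_simps(2) \<phi>_simps(2) by simp
      have "of_nat (n - 1) \<odot>\<^bsub>F\<^esub> (\<phi> x \<odot>\<^bsub>F\<^esub> T b) \<oplus>\<^bsub>F\<^esub>
          (- of_nat (n - 1)) \<odot>\<^bsub>F\<^esub> (\<phi> x \<odot>\<^bsub>F\<^esub> T b) = \<zero>\<^bsub>F\<^esub>"
        using F.scale_add_left[of "of_nat (n - 1)" "- of_nat (n - 1)" "\<phi> x \<odot>\<^bsub>F\<^esub> T b"] v
          F.scalars(2)[of "n - 1"] F.scalars_closed(4)[OF F.scalars(2)[of "n - 1"]] by simp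
      then show ?thesis
        using x v T_simps(2) F.scalars_closed(4)[OF F.scalars(2)[of "n - 1"]]
        by (simp add: F.M.a_assoc)
    qed
    \<comment> \<open>The nested restrictions reproduce the exact form of the sum of
      \<open>L\<close> and \<open>R\<close> in \<open>component_closed\<close>; off the carrier both
      sides are \<open>undefined\<close>.\<close>
    then have "T = (\<lambda>x\<in>carrier E.
        (\<lambda>x\<in>carrier E. T x \<oplus>\<^bsub>F\<^esub> of_nat (n - 1) \<odot>\<^bsub>F\<^esub> (\<phi> x \<odot>\<^bsub>F\<^esub> T b)) x \<oplus>\<^bsub>F\<^esub>
        (\<lambda>x\<in>carrier E. (- of_nat (n - 1)) \<odot>\<^bsub>F\<^esub> (\<phi> x \<odot>\<^bsub>F\<^esub> T b)) x)"
      using T_simps(1) by (auto simp: fun_eq_iff extensional_def)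
    then show ?thesis
      using component_closed(1)[OF assms(3) order_refl assms(4,5) L R] by simp
  qed
qed


end
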